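(* Any plus-welded knotoid diagram can be transformed into a trivial knotoid diagram by crossing virtualizations (used together with the moves generating plus-welded equivalence); that is, by a finite sequence of crossing virtualizations and moves $\Omega_1$–$\Omega_3$, $V\Omega_1$–$V\Omega_4$, $\Omega_v$, $\Phi_{\text{over}}$, $\Phi_+$.
   Context: Diagrams. A (plus-welded, or virtual) knotoid diagram is a generic immersion of $[0,1]$ into $S^2$ with finitely many transverse double points, each of which is either a classical crossing (with over/under information) or a virtual crossing (also called a welded crossing). The images of $0$ (the tail) and $1$ (the head) are distinct from each other and from the crossings. The diagram is oriented from tail to head. A trivial knotoid diagram is an embedding of $[0,1]$. Moves. Moves are local changes in a small disc, and are always considered together with isotopies of $S^2$. $\Omega_1,\Omega_2,\Omega_3$: the classical Reidemeister moves, performed away from the endpoints. $V\Omega_1,V\Omega_2,V\Omega_3$: the same with all crossings virtual. $V\Omega_4$: an arc having two virtual crossings is moved across a classical crossing. $\Omega_v$: a segment adjacent to the head or the tail is slid back or forward through a transversal strand, deleting or creating a virtual crossing. $\Phi_{\text{over}}$: an arc that is the over-strand at two classical crossings is moved across a virtual crossing. $\Phi_+$: a segment adjacent to the head or the tail is pulled over a transversal strand, deleting or creating a classical crossing at which this end segment is the over-strand. Plus-welded knotoids are equivalence classes of diagrams under these moves. A crossing virtualization is the local move replacing a classical crossing by a virtual crossing. *)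

theory Defs
  imports "HOL-Analysis.Analysis"
begin

section \<open>Diagrams on the two-sphere\<close>

abbreviation S2 :: "(real^3) set" where
  "S2 \<equiv> sphere 0 1"

text \<open>
  A diagram consists of a curve, of which only the values on \<open>{0..1}\<close> matter, and the set of
  all parameters at which the curve passes over a classical crossing. A crossing is classical
  if one of its two parameters lies in \<open>overs\<close>, and virtual (welded) otherwise.
\<close>

record diagram =
  curve :: "real \<Rightarrow> real^3"
  overs :: "real set"

definition crossing :: "diagram \<Rightarrow> real \<Rightarrow> real \<Rightarrow> bool" where
  "crossing D s t \<longleftrightarrow> s \<in> {0..1} \<and> t \<in> {0..1} \<and> s \<noteq> t \<and> curve D s = curve D t"

datatype kind = Over | Virtual

text \<open>
  \<open>crosses D Over s t\<close>: the branch at \<open>s\<close> passes over the branch at \<open>t\<close>;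
  \<open>crosses D Virtual s t\<close>: the two branches cross virtually (symmetric in \<open>s\<close> and \<open>t\<close>).
\<close>

definition crosses :: "diagram \<Rightarrow> kind \<Rightarrow> real \<Rightarrow> real \<Rightarrow> bool" where
  "crosses D k s t \<longleftrightarrow> crossing D s t \<and>
     (case k of Over \<Rightarrow> s \<in> overs D | Virtual \<Rightarrow> s \<notin> overs D \<and> t \<notin> overs D)"

definition smooth_curve :: "(real \<Rightarrow> real^3) \<Rightarrow> bool" where
  "smooth_curve f \<longleftrightarrow> (\<exists>F. F 0 = f \<and>
     (\<forall>k::nat. \<forall>t\<in>{0..1}. (F k has_vector_derivative F (Suc k) t) (at t within {0..1})))"

abbreviation velocity :: "diagram \<Rightarrow> real \<Rightarrow> real^3" where
  "velocity D t \<equiv> vector_derivative (curve D) (at t within {0..1})"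

text \<open>
  Velocities are tangent to the sphere, so two branches are transverse iff their velocities
  are linearly independent, i.e. not collinear with the origin.
\<close>

definition knotoid_diagram :: "diagram \<Rightarrow> bool" where
  "knotoid_diagram D \<longleftrightarrow>
     curve D ` {0..1} \<subseteq> S2 \<and>
     smooth_curve (curve D) \<and>
     (\<forall>t\<in>{0..1}. velocity D t \<noteq> 0) \<and>
     finite {(s, t). crossing D s t} \<and>
     (\<forall>s t u. crossing D s t \<and> crossing D s u \<longrightarrow> t = u) \<and>
     (\<forall>s t. crossing D s t \<longrightarrow> \<not> collinear {0, velocity D s, velocity D t}) \<and>
     (\<forall>t. \<not> crossing D 0 t \<and> \<not> crossing D 1 t) \<and>
     overs D \<subseteq> {s. \<exists>t. crossing D s t} \<and>
     (\<forall>s t. crossing D s t \<longrightarrow> \<not> (s \<in> overs D \<and> t \<in> overs D))"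

definition trivial_diagram :: "diagram \<Rightarrow> bool" where
  "trivial_diagram D \<longleftrightarrow> knotoid_diagram D \<and> inj_on (curve D) {0..1}"

definition virtualization :: "diagram \<Rightarrow> diagram \<Rightarrow> bool" where
  "virtualization D D' \<longleftrightarrow> knotoid_diagram D \<and> knotoid_diagram D' \<and>
     (\<exists>s t. crosses D Over s t \<and> curve D' = curve D \<and> overs D' = overs D - {s})"


section \<open>Isotopy of the sphere\<close>

text \<open>
  Orientation-preserving changes of parameter; they are automatically homeomorphisms.
\<close>

definition reparam :: "(real \<Rightarrow> real) \<Rightarrow> bool" where
  "reparam \<rho> \<longleftrightarrow> strict_mono_on {0..1} \<rho> \<and> \<rho> ` {0..1} = {0..1}"

definition isotopic :: "diagram \<Rightarrow> diagram \<Rightarrow> bool" where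
  "isotopic D D' \<longleftrightarrow> knotoid_diagram D \<and> knotoid_diagram D' \<and>
     (\<exists>h \<rho>. homotopic_with_canon (\<lambda>g. \<exists>g'. homeomorphism S2 S2 g g') S2 S2 id h \<and>
       reparam \<rho> \<and>
       (\<forall>t\<in>{0..1}. h (curve D t) = curve D' (\<rho> t) \<and> (t \<in> overs D \<longleftrightarrow> \<rho> t \<in> overs D')))"


section \<open>Local changes in a disc\<close>

definition closed_disc :: "(real^3) set \<Rightarrow> bool" where
  "closed_disc B \<longleftrightarrow> B \<subseteq> S2 \<and> B homeomorphic cball (0::real^2) 1"

abbreviation bd :: "(real^3) set \<Rightarrow> (real^3) set" where
  "bd B \<equiv> top_of_set S2 frontier_of B"

text \<open>
  The parameter interval \<open>[a, b]\<close> describes an arc in the disc \<open>B\<close> that meets the boundary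
  circle exactly at the ends of the arc, except that a tail (\<open>a = 0\<close>) or a head (\<open>b = 1\<close>)
  lies inside the disc.
\<close>

definition strand :: "diagram \<Rightarrow> (real^3) set \<Rightarrow> real \<times> real \<Rightarrow> bool" where
  "strand D B = (\<lambda>(a, b). 0 \<le> a \<and> a < b \<and> b \<le> 1 \<and> curve D ` {a..b} \<subseteq> B \<and>
     {t \<in> {a..b}. curve D t \<in> bd B} = {a, b} - {0, 1})"

abbreviation ivl :: "real \<times> real \<Rightarrow> real set" where
  "ivl I \<equiv> {fst I..snd I}"

text \<open>
  \<open>D\<close> meets the disc \<open>B\<close> exactly in the arcs parametrised by the disjoint intervals \<open>Is\<close>,
  and \<open>D'\<close> agrees with \<open>D\<close> outside the interior of \<open>B\<close>, up to the change of parameter \<open>\<rho>\<close>.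
  In particular \<open>D'\<close> meets \<open>B\<close> exactly in the arcs parametrised by the images of the \<open>Is\<close>
  under \<open>\<rho>\<close>. What happens inside \<open>B\<close> is prescribed separately for each move.
\<close>

definition local_change ::
  "(real \<times> real) list \<Rightarrow> (real \<Rightarrow> real) \<Rightarrow> diagram \<Rightarrow> diagram \<Rightarrow> bool" where
  "local_change Is \<rho> D D' \<longleftrightarrow> knotoid_diagram D \<and> knotoid_diagram D' \<and> reparam \<rho> \<and>
     (\<exists>B. closed_disc B \<and>
       (\<forall>I\<in>set Is. strand D B I) \<and>
       disjoint_family_on (\<lambda>i. ivl (Is ! i)) {..<length Is} \<and>
       {t \<in> {0..1}. curve D t \<in> B} = (\<Union>I\<in>set Is. ivl I) \<and>
       inj_on (curve D) {t \<in> {0..1}. curve D t \<in> bd B} \<and>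
       (\<forall>t\<in>{0..1}. curve D t \<in> B - bd B \<longleftrightarrow> curve D' (\<rho> t) \<in> B - bd B) \<and>
       (\<forall>t\<in>{0..1}. curve D t \<notin> B - bd B \<longrightarrow>
          curve D' (\<rho> t) = curve D t \<and> (t \<in> overs D \<longleftrightarrow> \<rho> t \<in> overs D')))"

abbreviation inner :: "real \<times> real \<Rightarrow> bool" where
  "inner I \<equiv> 0 < fst I \<and> snd I < 1"

text \<open>The crossings, as unordered pairs of parameters, among the arcs with parameters in \<open>T\<close>.\<close>

definition crossings_in :: "diagram \<Rightarrow> real set \<Rightarrow> real set set" where
  "crossings_in D T = {{s, t} | s t. s \<in> T \<and> t \<in> T \<and> crossing D s t}"


section \<open>Moves\<close>

text \<open>
  Each local picture is described by the number and type of the arcs in the disc together with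
  the complete list of crossings among them, which determines the picture in the disc
  up to homeomorphism. All orientations of the strands and all mirror images of the planar
  pictures are included. The first three patterns are those of the Reidemeister moves; the
  moves of plus-welded equivalence arise by specifying the kinds of the crossings.
\<close>

text \<open>An arc without crossings acquires a curl with a crossing of kind \<open>k\<close>.\<close>

definition curl_move :: "kind \<Rightarrow> diagram \<Rightarrow> diagram \<Rightarrow> bool" where
  "curl_move k D D' \<longleftrightarrow> (\<exists>I \<rho>. local_change [I] \<rho> D D' \<and> inner I \<and>
     crossings_in D (ivl I) = {} \<and>
     (\<exists>s t. crosses D' k s t \<and> crossings_in D' (\<rho> ` ivl I) = {{s, t}}))"

text \<open>
  Two arcs without crossings become two arcs crossing exactly twice, both crossings being of
  kind \<open>k\<close>; for \<open>k = Over\<close> the arc \<open>I\<close> is the over-strand at both crossings.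
\<close>

definition bigon_move :: "kind \<Rightarrow> diagram \<Rightarrow> diagram \<Rightarrow> bool" where
  "bigon_move k D D' \<longleftrightarrow> (\<exists>I J \<rho>. local_change [I, J] \<rho> D D' \<and> inner I \<and> inner J \<and>
     crossings_in D (ivl I \<union> ivl J) = {} \<and>
     (\<exists>s\<^sub>1\<in>\<rho> ` ivl I. \<exists>s\<^sub>2\<in>\<rho> ` ivl I. \<exists>t\<^sub>1\<in>\<rho> ` ivl J. \<exists>t\<^sub>2\<in>\<rho> ` ivl J. s\<^sub>1 \<noteq> s\<^sub>2 \<and>
        crosses D' k s\<^sub>1 t\<^sub>1 \<and> crosses D' k s\<^sub>2 t\<^sub>2 \<and>
        crossings_in D' (\<rho> ` (ivl I \<union> ivl J)) = {{s\<^sub>1, t\<^sub>1}, {s\<^sub>2, t\<^sub>2}}))"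

text \<open>
  Three arcs cross pairwise exactly once, with kinds \<open>k\<^sub>1\<^sub>2\<close>, \<open>k\<^sub>1\<^sub>3\<close>, \<open>k\<^sub>2\<^sub>3\<close>; here \<open>x\<^sub>i\<^sub>j\<close>
  is the parameter on the \<open>i\<close>-th arc of its crossing with the \<open>j\<close>-th arc.
\<close>

definition triangle :: "kind \<Rightarrow> kind \<Rightarrow> kind \<Rightarrow> diagram \<Rightarrow> real set \<Rightarrow> real set \<Rightarrow> real set \<Rightarrow>
    real \<Rightarrow> real \<Rightarrow> real \<Rightarrow> real \<Rightarrow> real \<Rightarrow> real \<Rightarrow> bool" where
  "triangle k\<^sub>1\<^sub>2 k\<^sub>1\<^sub>3 k\<^sub>2\<^sub>3 D T\<^sub>1 T\<^sub>2 T\<^sub>3 x\<^sub>1\<^sub>2 x\<^sub>1\<^sub>3 x\<^sub>2\<^sub>1 x\<^sub>2\<^sub>3 x\<^sub>3\<^sub>1 x\<^sub>3\<^sub>2 \<longleftrightarrow>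
     {x\<^sub>1\<^sub>2, x\<^sub>1\<^sub>3} \<subseteq> T\<^sub>1 \<and> {x\<^sub>2\<^sub>1, x\<^sub>2\<^sub>3} \<subseteq> T\<^sub>2 \<and> {x\<^sub>3\<^sub>1, x\<^sub>3\<^sub>2} \<subseteq> T\<^sub>3 \<and>
     crosses D k\<^sub>1\<^sub>2 x\<^sub>1\<^sub>2 x\<^sub>2\<^sub>1 \<and> crosses D k\<^sub>1\<^sub>3 x\<^sub>1\<^sub>3 x\<^sub>3\<^sub>1 \<and> crosses D k\<^sub>2\<^sub>3 x\<^sub>2\<^sub>3 x\<^sub>3\<^sub>2 \<and>
     crossings_in D (T\<^sub>1 \<union> T\<^sub>2 \<union> T\<^sub>3) = {{x\<^sub>1\<^sub>2, x\<^sub>2\<^sub>1}, {x\<^sub>1\<^sub>3, x\<^sub>3\<^sub>1}, {x\<^sub>2\<^sub>3, x\<^sub>3\<^sub>2}}"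

text \<open>
  Moving one of the three arcs across the crossing of the other two reverses, on each arc, the
  order of the two crossings on it.
\<close>

definition triangle_move :: "kind \<Rightarrow> kind \<Rightarrow> kind \<Rightarrow> diagram \<Rightarrow> diagram \<Rightarrow> bool" where
  "triangle_move k\<^sub>1\<^sub>2 k\<^sub>1\<^sub>3 k\<^sub>2\<^sub>3 D D' \<longleftrightarrow>
     (\<exists>I\<^sub>1 I\<^sub>2 I\<^sub>3 \<rho> x\<^sub>1\<^sub>2 x\<^sub>1\<^sub>3 x\<^sub>2\<^sub>1 x\<^sub>2\<^sub>3 x\<^sub>3\<^sub>1 x\<^sub>3\<^sub>2 y\<^sub>1\<^sub>2 y\<^sub>1\<^sub>3 y\<^sub>2\<^sub>1 y\<^sub>2\<^sub>3 y\<^sub>3\<^sub>1 y\<^sub>3\<^sub>2.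
       local_change [I\<^sub>1, I\<^sub>2, I\<^sub>3] \<rho> D D' \<and> inner I\<^sub>1 \<and> inner I\<^sub>2 \<and> inner I\<^sub>3 \<and>
       triangle k\<^sub>1\<^sub>2 k\<^sub>1\<^sub>3 k\<^sub>2\<^sub>3 D (ivl I\<^sub>1) (ivl I\<^sub>2) (ivl I\<^sub>3)
         x\<^sub>1\<^sub>2 x\<^sub>1\<^sub>3 x\<^sub>2\<^sub>1 x\<^sub>2\<^sub>3 x\<^sub>3\<^sub>1 x\<^sub>3\<^sub>2 \<and>
       triangle k\<^sub>1\<^sub>2 k\<^sub>1\<^sub>3 k\<^sub>2\<^sub>3 D' (\<rho> ` ivl I\<^sub>1) (\<rho> ` ivl I\<^sub>2) (\<rho> ` ivl I\<^sub>3)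
         y\<^sub>1\<^sub>2 y\<^sub>1\<^sub>3 y\<^sub>2\<^sub>1 y\<^sub>2\<^sub>3 y\<^sub>3\<^sub>1 y\<^sub>3\<^sub>2 \<and>
       (x\<^sub>1\<^sub>2 < x\<^sub>1\<^sub>3 \<longleftrightarrow> y\<^sub>1\<^sub>3 < y\<^sub>1\<^sub>2) \<and> (x\<^sub>2\<^sub>1 < x\<^sub>2\<^sub>3 \<longleftrightarrow> y\<^sub>2\<^sub>3 < y\<^sub>2\<^sub>1) \<and> (x\<^sub>3\<^sub>1 < x\<^sub>3\<^sub>2 \<longleftrightarrow> y\<^sub>3\<^sub>2 < y\<^sub>3\<^sub>1))"

text \<open>
  An end segment \<open>I\<close>, adjacent to the tail or to the head, is slid through a transversal
  strand \<open>J\<close>, creating a crossing of kind \<open>k\<close>; for \<open>k = Over\<close> the end segment passes over.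
\<close>

definition end_move :: "kind \<Rightarrow> diagram \<Rightarrow> diagram \<Rightarrow> bool" where
  "end_move k D D' \<longleftrightarrow> (\<exists>I J \<rho>. local_change [I, J] \<rho> D D' \<and> inner J \<and>
     (fst I = 0 \<and> snd I < 1 \<or> 0 < fst I \<and> snd I = 1) \<and>
     crossings_in D (ivl I \<union> ivl J) = {} \<and>
     (\<exists>s\<in>\<rho> ` ivl I. \<exists>t\<in>\<rho> ` ivl J. crosses D' k s t \<and>
        crossings_in D' (\<rho> ` (ivl I \<union> ivl J)) = {{s, t}}))"

abbreviation "Omega1 \<equiv> curl_move Over"
abbreviation "Omega2 \<equiv> bigon_move Over"
abbreviation "Omega3 \<equiv> triangle_move Over Over Over"
abbreviation "VOmega1 \<equiv> curl_move Virtual"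
abbreviation "VOmega2 \<equiv> bigon_move Virtual"
abbreviation "VOmega3 \<equiv> triangle_move Virtual Virtual Virtual"
abbreviation "VOmega4 \<equiv> triangle_move Virtual Virtual Over"
abbreviation "Phi_over \<equiv> triangle_move Over Over Virtual"
abbreviation "Omega_v \<equiv> end_move Virtual"
abbreviation "Phi_plus \<equiv> end_move Over"

definition pw_move :: "diagram \<Rightarrow> diagram \<Rightarrow> bool" where
  "pw_move D D' \<longleftrightarrow>
     Omega1 D D' \<or> Omega2 D D' \<or> Omega3 D D' \<or>
     VOmega1 D D' \<or> VOmega2 D D' \<or> VOmega3 D D' \<or> VOmega4 D D' \<or>
     Omega_v D D' \<or> Phi_over D D' \<or> Phi_plus D D'"

text \<open>Moves may be performed in either direction.\<close>

definition pw_step :: "diagram \<Rightarrow> diagram \<Rightarrow> bool" where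
  "pw_step D D' \<longleftrightarrow> isotopic D D' \<or> pw_move D D' \<or> pw_move D' D"

end

theory Submission
  imports Defs
begin

text \<open>
  Virtualize all crossings and then pull the head back along the curve. When the head passes a
  virtual crossing this is a move \<open>\<Omega>\<^sub>v\<close> in a small round cap about the crossing; elsewhere it is an
  isotopy supported in a small chart in which the curve is straight. As every parameter has a
  neighbourhood in which one of the two applies, the head can be moved so close to the tail that
  no crossings are left.
\<close>

subsection \<open>Truncated diagrams\<close>

text \<open>A truncation need not be a diagram: its head may land on an earlier point of the curve.
  Chains of moves must jump over these finitely many parameters, so the local statements speak about
  pairs of admissible heads near a parameter, not about the parameter itself. A formal move demands
  an explicit disc and a change of parameter, an isotopy a path of homeomorphisms of the whole
  sphere. Retracting along a fixed curve keeps both manageable: two truncations trace the same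
  points up to the shorter head. For the move only parameters have to be matched; for the isotopy a
  slide along the curve has to be extended to the sphere. Both constructions rest on short arcs
  along which the continuous, nonvanishing velocity forces monotonicity: of the distance from the
  crossing for the cap, of a tangential coordinate for the chart.\<close>

definition trunc :: "diagram \<Rightarrow> real \<Rightarrow> diagram" where
  "trunc D c = \<lparr>curve = (\<lambda>t. curve D (c * t)), overs = {}\<rparr>"

text \<open>The one clause of \<open>knotoid_diagram\<close> that truncation can break is that the
  head lies on no crossing. Later parameters are cut off, so only those before \<open>c\<close> are
  compared.\<close>

definition valid :: "diagram \<Rightarrow> real \<Rightarrow> bool" where
  "valid D c \<longleftrightarrow> (\<forall>s. 0 \<le> s \<and> s < c \<longrightarrow> curve D s \<noteq> curve D c)"

lemma curve_trunc [simp]: "curve (trunc D c) t = curve D (c * t)"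
  by (simp add: trunc_def)

lemma overs_trunc [simp]: "overs (trunc D c) = {}"
  by (simp add: trunc_def)

lemma crossing_sym: "crossing D s t \<Longrightarrow> crossing D t s"
  by (auto simp: crossing_def)

lemma crossing_trunc:
  assumes "0 < c" "c \<le> 1"
  shows "crossing (trunc D c) s t \<longleftrightarrow>
    s \<in> {0..1} \<and> t \<in> {0..1} \<and> crossing D (c * s) (c * t)"
  using assms by (auto simp: crossing_def mult_le_one)

lemma finite_crossing_parameters:
  assumes "knotoid_diagram D"
  shows "finite {s. \<exists>t. crossing D s t}"
proof -
  have "finite (fst ` {(s, t). crossing D s t})"
    using assms by (simp add: knotoid_diagram_def)
  moreover have "{s. \<exists>t. crossing D s t} = fst ` {(s, t). crossing D s t}"
    by force
  ultimately show ?thesis by simp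
qed

lemma smooth_curve_derivatives:
  assumes "smooth_curve f"
  obtains F where "F 0 = f"
    "\<And>k t. t \<in> {0..1} \<Longrightarrow> (F k has_vector_derivative F (Suc k) t) (at t within {0..1})"
  using assms unfolding smooth_curve_def by blast

lemma velocity_eq:
  assumes "(curve D has_vector_derivative v) (at t within {0..1})" "t \<in> {0..1}"
  shows "velocity D t = v"
  using vector_derivative_within_cbox[of 0 1 t "curve D" v] assms by simp

lemma has_velocity:
  assumes "smooth_curve (curve D)" "t \<in> {0..1}"
  shows "(curve D has_vector_derivative velocity D t) (at t within {0..1})"
proof -
  obtain F where F: "F 0 = curve D"
    "\<And>k t. t \<in> {0..1} \<Longrightarrow> (F k has_vector_derivative F (Suc k) t) (at t within {0..1})"
    using assms(1) by (rule smooth_curve_derivatives) blast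
  show ?thesis
    using F(1) F(2)[OF assms(2), of 0] velocity_eq[of D "F 1 t" t] assms(2) by simp
qed

lemma continuous_on_velocity:
  assumes "smooth_curve (curve D)"
  shows "continuous_on {0..1} (velocity D)"
proof -
  obtain F where F: "F 0 = curve D"
    "\<And>k t. t \<in> {0..1} \<Longrightarrow> (F k has_vector_derivative F (Suc k) t) (at t within {0..1})"
    using assms by (rule smooth_curve_derivatives) blast
  have "continuous_on {0..1} (F 1)"
    unfolding continuous_on_eq_continuous_within
    using F(2)[of _ 1] by (blast intro: has_vector_derivative_continuous)
  moreover have "velocity D t = F 1 t" if "t \<in> {0..1}" for t
    using F(1) F(2)[OF that, of 0] that by (simp add: velocity_eq)
  ultimately show ?thesis by (metis (no_types, lifting) continuous_on_cong)
qed

lemma continuous_on_curve: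
  fixes D :: diagram
  assumes "smooth_curve (curve D)"
  shows "continuous_on {0..1} (curve D)"
  unfolding continuous_on_eq_continuous_within
  using has_velocity[OF assms] by (blast intro: has_vector_derivative_continuous)

lemma has_derivative_scaled:
  assumes c: "0 < c" "c \<le> 1" and t: "t \<in> {0..1}"
    and f: "\<And>t. t \<in> {0..1} \<Longrightarrow> (f has_vector_derivative f' t) (at t within {0..1})"
  shows "((\<lambda>t. f (c * t)) has_vector_derivative c *\<^sub>R f' (c * t)) (at t within {0..1::real})"
proof -
  have ct: "c * t \<in> {0..1}" using c t by (simp add: mult_le_one)
  have sub: "(*) c ` {0..1} \<subseteq> {0..1}" using c by (auto simp: mult_le_one)
  have "((*) c has_vector_derivative c) (at t within {0..1})"
    by (auto intro!: derivative_eq_intros)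
  from vector_diff_chain_within[OF this has_vector_derivative_within_subset[OF f[OF ct] sub]]
  show ?thesis by (simp add: o_def)
qed

lemma smooth_curve_trunc:
  assumes "smooth_curve (curve D)" and c: "0 < c" "c \<le> 1"
  shows "smooth_curve (curve (trunc D c))"
proof -
  obtain F where F: "F 0 = curve D"
    "\<And>k t. t \<in> {0..1} \<Longrightarrow> (F k has_vector_derivative F (Suc k) t) (at t within {0..1})"
    using assms(1) by (rule smooth_curve_derivatives) blast
  \<comment> \<open>The chain rule contributes one factor \<open>c\<close> for each derivative of
    \<open>t \<mapsto> curve D (c * t)\<close>.\<close>
  define G where "G = (\<lambda>k t. c ^ k *\<^sub>R F k (c * t))"
  have "(G k has_vector_derivative G (Suc k) t) (at t within {0..1})" if "t \<in> {0..1}" for k t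
    unfolding G_def
    using bounded_linear.has_vector_derivative[OF bounded_linear_scaleR_right
        has_derivative_scaled[OF c that F(2)], of "c ^ k" k]
    by (simp add: mult.commute)
  moreover have "G 0 = curve (trunc D c)" by (simp add: G_def F(1) trunc_def)
  ultimately show ?thesis unfolding smooth_curve_def by blast
qed

lemma velocity_trunc:
  assumes "smooth_curve (curve D)" "0 < c" "c \<le> 1" "t \<in> {0..1}"
  shows "velocity (trunc D c) t = c *\<^sub>R velocity D (c * t)"
  using has_derivative_scaled[OF assms(2-4) has_velocity[OF assms(1)]] assms(4)
  by (intro velocity_eq) (simp_all add: trunc_def)

text \<open>Multiplication by \<open>c\<close> injects the crossings of the truncation into those of
  \<open>D\<close> and rescales velocities by a positive factor, so finiteness, uniqueness of
  partners and transversality are inherited. The condition at the new head is supplied by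
  \<open>valid\<close>.\<close>

lemma knotoid_diagram_trunc:
  assumes D: "knotoid_diagram D" and c: "0 < c" "c \<le> 1" and valid: "valid D c"
  shows "knotoid_diagram (trunc D c)"
  unfolding knotoid_diagram_def
proof (intro conjI allI ballI impI)
  note D' = D[unfolded knotoid_diagram_def]
  have smooth: "smooth_curve (curve D)" using D' by blast
  have scaled: "c * t \<in> {0..1}" if "t \<in> {0..1}" for t
    using c that by (simp add: mult_le_one)
  show "curve (trunc D c) ` {0..1} \<subseteq> S2"
    using D' scaled by (auto simp: image_subset_iff)
  show "smooth_curve (curve (trunc D c))"
    using smooth c by (rule smooth_curve_trunc)
  show "velocity (trunc D c) t \<noteq> 0" if "t \<in> {0..1}" for t
    using D' scaled[OF that] c by (simp add: velocity_trunc[OF smooth c that])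
  show "finite {(s, t). crossing (trunc D c) s t}"
  proof (rule finite_imageD)
    show "inj_on (map_prod ((*) c) ((*) c)) {(s, t). crossing (trunc D c) s t}"
      using c by (auto simp: inj_on_def)
    show "finite (map_prod ((*) c) ((*) c) ` {(s, t). crossing (trunc D c) s t})"
      by (rule finite_subset[of _ "{(s, t). crossing D s t}"])
        (use D' in \<open>auto simp: crossing_trunc[OF c]\<close>)
  qed
  show "t = u" if "crossing (trunc D c) s t \<and> crossing (trunc D c) s u" for s t u
  proof -
    have "c * t = c * u" using that D' unfolding crossing_trunc[OF c] by blast
    thus ?thesis using c by simp
  qed
  show "\<not> collinear {0, velocity (trunc D c) s, velocity (trunc D c) t}"
    if "crossing (trunc D c) s t" for s t
    using that D' c
    by (simp add: crossing_trunc[OF c] velocity_trunc[OF smooth c] collinear_scaleR_iff)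
  show "\<not> crossing (trunc D c) 0 t" for t
    using D' by (simp add: crossing_trunc[OF c])
  show "\<not> crossing (trunc D c) 1 t" for t
  proof
    assume "crossing (trunc D c) 1 t"
    hence "0 \<le> t" "t < 1" "curve D c = curve D (c * t)" by (auto simp: crossing_def)
    moreover from this c have "0 \<le> c * t" "c * t < c" by simp_all
    ultimately show False using valid by (metis valid_def)
  qed
qed auto

text \<open>Each virtualization deletes one parameter from \<open>overs\<close> and leaves the curve
  alone, so the number of classical crossings drops until the diagram is the truncation at the
  original head.\<close>

lemma virtualize_all:
  assumes "knotoid_diagram D"
  shows "(\<lambda>E E'. virtualization E E' \<or> pw_step E E')\<^sup>*\<^sup>* D (trunc D 1)"
  using assms
proof (induction "card (overs D)" arbitrary: D)
  case 0
  \<comment> \<open>An infinite set also has \<open>card\<close> equal to 0, so emptiness needs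
    finiteness.\<close>
  have "finite (overs D)"
    using finite_crossing_parameters[OF 0(2)] 0(2)
    by (auto simp: knotoid_diagram_def elim: finite_subset[rotated])
  with 0 have "overs D = {}" by simp
  hence "trunc D 1 = D" by (simp add: trunc_def)
  thus ?case by simp
next
  case (Suc n)
  have fin: "finite (overs D)"
    using Suc(2) card.infinite by fastforce
  obtain s where s: "s \<in> overs D" using Suc(2) by fastforce
  obtain t where t: "crossing D s t"
    using s Suc(3) by (auto simp: knotoid_diagram_def)
  define E where "E = D\<lparr>overs := overs D - {s}\<rparr>"
  have [simp]: "crossing E = crossing D" by (intro ext) (simp add: crossing_def E_def)
  have "knotoid_diagram E"
    using Suc(3) unfolding knotoid_diagram_def \<open>crossing E = crossing D\<close>
    by (auto simp: E_def)
  moreover from this have "virtualization D E"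
    unfolding virtualization_def crosses_def using s t Suc(3) by (auto simp: E_def)
  moreover have "n = card (overs E)" using Suc(2) s fin by (simp add: E_def)
  moreover have "trunc E 1 = trunc D 1" by (simp add: trunc_def E_def)
  ultimately have "virtualization D E \<or> pw_step D E"
    "(\<lambda>E E'. virtualization E E' \<or> pw_step E E')\<^sup>*\<^sup>* E (trunc D 1)"
    using Suc(1)[of E] by simp_all
  thus ?case by (rule converse_rtranclp_into_rtranclp)
qed

subsection \<open>Round caps\<close>

text \<open>For unit vectors the squared distance is \<open>2 - 2 * (p \<bullet> q)\<close>. A round
  cap is thus a slice of the sphere by a half-space, and its rim has constant height
  \<open>1 - r\<^sup>2 / 2\<close> over the plane orthogonal to \<open>p\<close>.\<close>

lemma cball_sphere_iff:
  fixes p q :: "'a::real_inner"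
  assumes "norm p = 1" "norm q = 1" "0 \<le> r"
  shows "dist p q \<le> r \<longleftrightarrow> 1 - r\<^sup>2 / 2 \<le> p \<bullet> q"
    and "dist p q = r \<longleftrightarrow> p \<bullet> q = 1 - r\<^sup>2 / 2"
proof -
  have d: "(dist p q)\<^sup>2 = 2 - 2 * (p \<bullet> q)"
    using assms by (simp add: dist_norm power2_norm_eq_inner inner_diff inner_commute norm_eq_1)
  have "dist p q \<le> r \<longleftrightarrow> (dist p q)\<^sup>2 \<le> r\<^sup>2"
    using assms(3) by simp
  thus "dist p q \<le> r \<longleftrightarrow> 1 - r\<^sup>2 / 2 \<le> p \<bullet> q"
    using d by auto
  have "dist p q = r \<longleftrightarrow> (dist p q)\<^sup>2 = r\<^sup>2"
    using assms(3) by simp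
  thus "dist p q = r \<longleftrightarrow> p \<bullet> q = 1 - r\<^sup>2 / 2"
    using d by auto
qed

text \<open>Orthogonal projection along \<open>p\<close> flattens the cap to a planar disc. Since
  \<open>r < 1\<close>, the rim height \<open>k\<close> is positive, so a point is recovered from
  its shadow by taking the positive square root as its height.\<close>

lemma closed_disc_cap:
  assumes p: "p \<in> S2" and r: "0 < r" "r < 1"
  shows "closed_disc (S2 \<inter> cball p r)"
  unfolding closed_disc_def
proof
  define k where "k = 1 - r\<^sup>2 / 2"
  have k: "0 < k" "k < 1" using r power_less_one_iff[of r 2] by (auto simp: k_def)
  have pp: "norm p = 1" "p \<bullet> p = 1" using p by (simp_all add: norm_eq_1)
  define S where "S = {x. p \<bullet> x = 0} \<inter> cball 0 (sqrt (1 - k\<^sup>2))"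
  have k2: "k\<^sup>2 < 1" using k by (simp add: power_less_one_iff)
  have cap: "S2 \<inter> cball p r = {q. norm q = 1 \<and> k \<le> p \<bullet> q}"
    using cball_sphere_iff(1)[OF pp(1), of _ r] r by (auto simp: k_def)
  have decomp: "norm (q - (p \<bullet> q) *\<^sub>R p) ^ 2 = norm q ^ 2 - (p \<bullet> q)\<^sup>2" for q
    unfolding power2_norm_eq_inner using pp(2)
    by (simp add: inner_diff inner_commute power2_eq_square)
  have "homeomorphism (S2 \<inter> cball p r) S (\<lambda>q. q - (p \<bullet> q) *\<^sub>R p)
     (\<lambda>x. x + sqrt (1 - norm x ^ 2) *\<^sub>R p)"
  proof (rule homeomorphismI)
    show "continuous_on (S2 \<inter> cball p r) (\<lambda>q. q - (p \<bullet> q) *\<^sub>R p)"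
      by (intro continuous_intros)
    show "continuous_on S (\<lambda>x. x + sqrt (1 - norm x ^ 2) *\<^sub>R p)"
      by (intro continuous_intros)
    show "(\<lambda>q. q - (p \<bullet> q) *\<^sub>R p) ` (S2 \<inter> cball p r) \<subseteq> S"
    proof (rule image_subsetI)
      fix q assume "q \<in> S2 \<inter> cball p r"
      hence q: "norm q = 1" "k \<le> p \<bullet> q" unfolding cap by auto
      have "k\<^sup>2 \<le> (p \<bullet> q)\<^sup>2" using q(2) k(1) by simp
      hence "norm (q - (p \<bullet> q) *\<^sub>R p) \<le> sqrt (1 - k\<^sup>2)"
        using decomp[of q] q(1) by (intro real_le_rsqrt) simp
      thus "q - (p \<bullet> q) *\<^sub>R p \<in> S"
        using pp(2) by (simp add: S_def inner_diff)
    qed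
    show "(\<lambda>x. x + sqrt (1 - norm x ^ 2) *\<^sub>R p) ` S \<subseteq> S2 \<inter> cball p r"
    proof (rule image_subsetI)
      fix x assume "x \<in> S"
      hence x: "p \<bullet> x = 0" "norm x \<le> sqrt (1 - k\<^sup>2)" by (auto simp: S_def)
      have nx: "norm x ^ 2 \<le> 1 - k\<^sup>2"
        using power_mono[OF x(2), of 2] k2 by simp
      have *: "p \<bullet> (x + sqrt (1 - norm x ^ 2) *\<^sub>R p) = sqrt (1 - norm x ^ 2)"
        using x pp by (simp add: inner_add)
      have "k \<le> sqrt (1 - norm x ^ 2)" using nx k by (intro real_le_rsqrt) simp
      moreover have "norm (x + sqrt (1 - norm x ^ 2) *\<^sub>R p) ^ 2 = 1"
      proof -
        have "0 \<le> 1 - norm x ^ 2" using nx zero_le_power2[of k] by linarith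
        hence "norm x ^ 2 + sqrt (1 - norm x ^ 2) * sqrt (1 - norm x ^ 2) = 1" by simp
        thus ?thesis
          using x(1) pp(2) by (simp add: power2_norm_eq_inner inner_add inner_commute)
      qed
      ultimately show "x + sqrt (1 - norm x ^ 2) *\<^sub>R p \<in> S2 \<inter> cball p r"
        unfolding cap using * by (simp add: power2_eq_1_iff) (smt (verit) norm_ge_zero)
    qed
    show "q - (p \<bullet> q) *\<^sub>R p + sqrt (1 - norm (q - (p \<bullet> q) *\<^sub>R p) ^ 2) *\<^sub>R p = q"
      if "q \<in> S2 \<inter> cball p r" for q
    proof -
      have q: "norm q = 1" "k \<le> p \<bullet> q" using that unfolding cap by auto
      have "sqrt (1 - norm (q - (p \<bullet> q) *\<^sub>R p) ^ 2) = p \<bullet> q"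
        using q k unfolding decomp by simp
      thus ?thesis by simp
    qed
    show "x + sqrt (1 - norm x ^ 2) *\<^sub>R p - (p \<bullet> (x + sqrt (1 - norm x ^ 2) *\<^sub>R p)) *\<^sub>R p = x"
      if "x \<in> S" for x
      using that pp by (simp add: S_def inner_add)
  qed
  hence "S2 \<inter> cball p r homeomorphic S"
    unfolding homeomorphic_def by blast
  \<comment> \<open>Compact convex sets of equal affine dimension are homeomorphic, which avoids
    choosing coordinates in the plane orthogonal to \<open>p\<close>.\<close>
  moreover have "S homeomorphic cball (0::real^2) 1"
  proof (rule homeomorphic_convex_compact_sets)
    show "convex S" "compact S"
      unfolding S_def by (auto intro!: convex_Int convex_hyperplane closed_Int_compact closed_hyperplane)
    have "0 \<in> {x. p \<bullet> x = 0} \<inter> interior (cball 0 (sqrt (1 - k\<^sup>2)))"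
      using k2 by simp
    hence "aff_dim S = aff_dim {x. p \<bullet> x = 0}"
      unfolding S_def by (intro aff_dim_convex_Int_nonempty_interior convex_hyperplane) blast
    also have "\<dots> = 2" using pp by (subst aff_dim_hyperplane) auto
    finally show "aff_dim S = aff_dim (cball (0::real^2) 1)"
      by (simp add: aff_dim_cball)
  qed auto
  ultimately show "S2 \<inter> cball p r homeomorphic cball (0::real^2) 1"
    by (rule homeomorphic_trans)
qed auto

text \<open>The point at issue is that no point at distance exactly \<open>r\<close> is interior
  relative to the sphere: the great circle from \<open>p\<close> through such a point leaves the cap
  immediately after it.\<close>

lemma bd_cap:
  assumes p: "p \<in> S2" and r: "0 < r" "r < 1"
  shows "bd (S2 \<inter> cball p r) = S2 \<inter> sphere p r"
proof -
  define k where "k = 1 - r\<^sup>2 / 2"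
  have k: "0 < k" "k < 1" using r power_less_one_iff[of r 2] by (auto simp: k_def)
  have pp: "norm p = 1" "p \<bullet> p = 1" using p by (simp_all add: norm_eq_1)
  have "closedin (top_of_set S2) (S2 \<inter> cball p r)"
    by (simp add: closedin_closed_Int)
  hence closure: "top_of_set S2 closure_of (S2 \<inter> cball p r) = S2 \<inter> cball p r"
    by (simp add: closure_of_closedin)
  have interior: "top_of_set S2 interior_of (S2 \<inter> cball p r) = S2 \<inter> ball p r"
  proof (rule interior_of_unique)
    show "S2 \<inter> ball p r \<subseteq> S2 \<inter> cball p r" by auto
    show "openin (top_of_set S2) (S2 \<inter> ball p r)" by (simp add: openin_open_Int)
    fix U assume U: "U \<subseteq> S2 \<inter> cball p r" "openin (top_of_set S2) U"
    show "U \<subseteq> S2 \<inter> ball p r"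
    proof
      fix q assume q: "q \<in> U"
      have "dist p q \<noteq> r"
      proof
        assume "dist p q = r"
        moreover have nq: "norm q = 1" using q U by auto
        ultimately have pq: "p \<bullet> q = k"
          using cball_sphere_iff(2)[OF pp(1), of q r] r by (simp add: k_def)
        \<comment> \<open>\<open>u\<close> is the unit tangent vector at \<open>p\<close> towards
          \<open>q\<close>; \<open>f\<close> is the great circle they span, parametrised by the
          angle from \<open>p\<close>, and reaches \<open>q\<close> at the angle
          \<open>a\<close>.\<close>
        define u where "u = (1 / sqrt (1 - k\<^sup>2)) *\<^sub>R (q - k *\<^sub>R p)"
        have k2: "k\<^sup>2 < 1" using k by (simp add: power_less_one_iff)
        have u: "p \<bullet> u = 0" "u \<bullet> u = 1"
          using pq pp nq k2 by (simp_all add: u_def inner_diff inner_commute norm_eq_1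
              field_simps flip: power2_eq_square)
        define f where "f = (\<lambda>\<theta>. cos \<theta> *\<^sub>R p + sin \<theta> *\<^sub>R u)"
        define a where "a = arccos k"
        have a: "0 < a" "a < pi" "cos a = k" "sin a = sqrt (1 - k\<^sup>2)"
          using k by (auto simp: a_def arccos_lt_bounded sin_arccos)
        have fa: "f a = q" using a(3,4) k2 by (simp add: f_def u_def)
        have fS: "f \<theta> \<in> S2" for \<theta>
          using pp(2) u by (simp add: f_def norm_eq_1 inner_add inner_commute
              flip: power2_eq_square)
        have fp: "p \<bullet> f \<theta> = cos \<theta>" for \<theta>
          using pp(2) u by (simp add: f_def inner_add)
        obtain W where W: "open W" "U = S2 \<inter> W"
          using U(2) by (auto simp: openin_open)
        have "isCont f a" unfolding f_def by (intro continuous_intros)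
        hence "\<forall>\<^sub>F \<theta> in at a. f \<theta> \<in> W"
          using W q fa by (auto simp: isCont_def dest: topological_tendstoD)
        then obtain d where d: "d > 0" "\<And>\<theta>. \<theta> \<noteq> a \<Longrightarrow> dist \<theta> a < d \<Longrightarrow> f \<theta> \<in> W"
          unfolding eventually_at by blast
        \<comment> \<open>Capping at \<open>pi\<close> keeps the angle in the range where
          \<open>cos\<close> strictly decreases.\<close>
        define \<theta> where "\<theta> = min (a + d / 2) pi"
        have \<theta>: "a < \<theta>" "\<theta> \<le> pi" "dist \<theta> a < d"
          using a d by (auto simp: \<theta>_def dist_real_def)
        have "f \<theta> \<in> U" using d(2)[of \<theta>] \<theta> W(2) fS by auto
        hence "dist p (f \<theta>) \<le> r" using U(1) by auto
        hence "k \<le> cos \<theta>"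
          using cball_sphere_iff(1)[OF pp(1), of "f \<theta>" r] r fS[of \<theta>] fp by (simp add: k_def)
        moreover have "cos \<theta> < cos a" using a \<theta> by (intro cos_monotone_0_pi) auto
        ultimately show False using a by simp
      qed
      thus "q \<in> S2 \<inter> ball p r" using q U(1) by force
    qed
  qed
  show ?thesis unfolding frontier_of_def closure interior by auto
qed

section \<open>Monotonicity along short arcs of the curve\<close>

text \<open>Continuity keeps all nearby velocities close to the nonzero velocity at
  \<open>t0\<close>. Acute angles between every two of them allow any velocity of the arc to serve
  as a direction in which the arc advances.\<close>

lemma velocity_acute_nearby:
  assumes D: "knotoid_diagram D" and t0: "t0 \<in> {0..1}"
  obtains \<delta> where "\<delta> > 0"
    "\<And>s t. s \<in> {0..1} \<Longrightarrow> t \<in> {0..1} \<Longrightarrow> \<bar>s - t0\<bar> \<le> \<delta> \<Longrightarrow> \<bar>t - t0\<bar> \<le> \<delta> \<Longrightarrow>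
       velocity D s \<bullet> velocity D t > 0"
proof -
  let ?v = "velocity D"
  have cont: "continuous_on {0..1} ?v"
    using D by (intro continuous_on_velocity) (simp add: knotoid_diagram_def)
  have v0: "?v t0 \<noteq> 0" using D t0 by (simp add: knotoid_diagram_def)
  \<comment> \<open>With deviations of at most a quarter of the norm, the three error terms in the
    inner product take away at most 1/4 + 1/4 + 1/16 of \<open>w \<bullet> w\<close>.\<close>
  have "norm (?v t0) / 4 > 0" using v0 by simp
  then obtain d where d: "d > 0"
    "\<And>s. s \<in> {0..1} \<Longrightarrow> dist s t0 < d \<Longrightarrow> dist (?v s) (?v t0) < norm (?v t0) / 4"
    using cont t0 unfolding continuous_on_iff by blast
  have "?v s \<bullet> ?v t > 0"
    if "s \<in> {0..1}" "t \<in> {0..1}" "\<bar>s - t0\<bar> \<le> d / 2" "\<bar>t - t0\<bar> \<le> d / 2" for s t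
  proof -
    define w a b where "w = ?v t0" and "a = ?v s - w" and "b = ?v t - w"
    have ab: "norm a \<le> norm w / 4" "norm b \<le> norm w / 4"
      using d(2)[of s] d(2)[of t] that d(1) by (auto simp: a_def b_def w_def dist_norm)
    have "?v s \<bullet> ?v t = w \<bullet> w + a \<bullet> w + w \<bullet> b + a \<bullet> b"
      by (simp add: a_def b_def inner_diff algebra_simps)
    moreover have "\<bar>a \<bullet> w\<bar> \<le> norm w / 4 * norm w" "\<bar>w \<bullet> b\<bar> \<le> norm w * (norm w / 4)"
      "\<bar>a \<bullet> b\<bar> \<le> norm w / 4 * (norm w / 4)"
      by (intro order.trans[OF Cauchy_Schwarz_ineq2] mult_mono ab order_refl norm_ge_zero; simp)+
    moreover have "w \<bullet> w = norm w * norm w" "norm w * norm w > 0"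
      using v0 by (simp_all add: w_def dot_square_norm power2_eq_square)
    ultimately show ?thesis by linarith
  qed
  thus thesis using that[of "d / 2"] d(1) by simp
qed

lemma curve_increasing_along:
  assumes smooth: "smooth_curve (curve D)" and ab: "0 \<le> a" "a < b" "b \<le> 1"
    and w: "\<And>x. a \<le> x \<Longrightarrow> x \<le> b \<Longrightarrow> velocity D x \<bullet> w > 0"
  shows "curve D a \<bullet> w < curve D b \<bullet> w"
proof -
  have "((\<lambda>x. curve D x \<bullet> w) has_derivative (\<lambda>h. h * (velocity D x \<bullet> w))) (at x within {a..b})"
    if "x \<in> {a..b}" for x
  proof -
    have "{a..b} \<subseteq> {0..1}" using ab by auto
    hence "(curve D has_vector_derivative velocity D x) (at x within {a..b})"
      using has_vector_derivative_within_subset[OF has_velocity[OF smooth]] that by blast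
    thus ?thesis
      unfolding has_vector_derivative_def by (auto intro!: derivative_eq_intros)
  qed
  hence "\<exists>\<xi>\<in>{a<..<b}. curve D b \<bullet> w - curve D a \<bullet> w = (\<lambda>h. h * (velocity D \<xi> \<bullet> w)) (b - a)"
    by (intro mvt_simple[OF ab(2)]) auto
  then obtain \<xi> where "a < \<xi>" "\<xi> < b" "curve D b \<bullet> w - curve D a \<bullet> w = (b - a) * (velocity D \<xi> \<bullet> w)"
    by auto
  moreover from this have "0 < (b - a) * (velocity D \<xi> \<bullet> w)"
    using w[of \<xi>] ab by (intro mult_pos_pos) auto
  ultimately show ?thesis by linarith
qed

text \<open>The derivative of the squared distance from \<open>curve D t0\<close> at
  \<open>\<xi>\<close> is twice the inner product of the chord with the velocity at
  \<open>\<xi>\<close>. That velocity is acute to all velocities between \<open>t0\<close> and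
  \<open>\<xi>\<close>, so the curve advances in its direction and the sign of the product is the
  side of \<open>t0\<close> on which \<open>\<xi>\<close> lies.\<close>

lemma distance_from_crossing_monotone:
  assumes D: "knotoid_diagram D" and t0: "t0 \<in> {0..1}"
    and acute: "\<And>s t. s \<in> {0..1} \<Longrightarrow> t \<in> {0..1} \<Longrightarrow> \<bar>s - t0\<bar> \<le> \<delta> \<Longrightarrow> \<bar>t - t0\<bar> \<le> \<delta> \<Longrightarrow>
       velocity D s \<bullet> velocity D t > 0"
    and st: "s \<in> {0..1}" "t \<in> {0..1}" "\<bar>s - t0\<bar> \<le> \<delta>" "\<bar>t - t0\<bar> \<le> \<delta>" "s < t"
  shows "t0 \<le> s \<Longrightarrow> dist (curve D t0) (curve D s) < dist (curve D t0) (curve D t)"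
    and "t \<le> t0 \<Longrightarrow> dist (curve D t0) (curve D t) < dist (curve D t0) (curve D s)"
proof -
  let ?v = "velocity D" and ?p = "curve D t0"
  have smooth: "smooth_curve (curve D)" using D by (simp add: knotoid_diagram_def)
  have sq: "dist ?p (curve D x) ^ 2 = (curve D x - ?p) \<bullet> (curve D x - ?p)" for x
    by (simp add: dist_norm norm_minus_commute flip: power2_norm_eq_inner)
  have der2: "((\<lambda>x. (curve D x - ?p) \<bullet> (curve D x - ?p)) has_derivative
      (\<lambda>h. h * (2 * ((curve D x - ?p) \<bullet> ?v x)))) (at x within {s..t})" if "x \<in> {s..t}" for x
  proof -
    have "(curve D has_vector_derivative ?v x) (at x within {s..t})"
      using has_vector_derivative_within_subset[OF has_velocity[OF smooth]] that st
      by (meson atLeastAtMost_iff atLeastatMost_subset_iff order.trans)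
    thus ?thesis
      unfolding has_vector_derivative_def
      by (auto intro!: derivative_eq_intros simp: inner_commute algebra_simps)
  qed
  have "\<exists>\<xi>\<in>{s<..<t}. (curve D t - ?p) \<bullet> (curve D t - ?p) - (curve D s - ?p) \<bullet> (curve D s - ?p)
      = (\<lambda>h. h * (2 * ((curve D \<xi> - ?p) \<bullet> ?v \<xi>))) (t - s)"
    by (rule mvt_simple[OF st(5)]) (use der2 in auto)
  then obtain \<xi> where \<xi>: "s < \<xi>" "\<xi> < t"
    "dist ?p (curve D t) ^ 2 - dist ?p (curve D s) ^ 2 = (t - s) * (2 * ((curve D \<xi> - ?p) \<bullet> ?v \<xi>))"
    unfolding sq by auto
  have less: "dist ?p x < dist ?p y" if "dist ?p x ^ 2 < dist ?p y ^ 2" for x y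
    using that by (rule power_less_imp_less_base) simp
  show "dist ?p (curve D s) < dist ?p (curve D t)" if "t0 \<le> s"
  proof (rule less)
    have "curve D t0 \<bullet> ?v \<xi> < curve D \<xi> \<bullet> ?v \<xi>"
      by (rule curve_increasing_along[OF smooth]) (use that \<xi> st t0 acute in auto)
    hence "(curve D \<xi> - ?p) \<bullet> ?v \<xi> > 0" by (simp add: inner_diff)
    thus "dist ?p (curve D s) ^ 2 < dist ?p (curve D t) ^ 2"
      using \<xi> st(5) by (smt (verit) mult_pos_pos)
  qed
  show "dist ?p (curve D t) < dist ?p (curve D s)" if "t \<le> t0"
  proof (rule less)
    have "curve D \<xi> \<bullet> ?v \<xi> < curve D t0 \<bullet> ?v \<xi>"
      by (rule curve_increasing_along[OF smooth]) (use that \<xi> st t0 acute in auto)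
    hence "(t - s) * (2 * ((curve D \<xi> - ?p) \<bullet> ?v \<xi>)) < 0"
      using st(5) by (simp add: inner_diff mult_less_0_iff)
    thus "dist ?p (curve D t) ^ 2 < dist ?p (curve D s) ^ 2"
      using \<xi> by linarith
  qed
qed

subsection \<open>Pulling the head back through a crossing\<close>

lemma strict_mono_on_image_interval:
  fixes \<sigma> :: "real \<Rightarrow> real"
  assumes "a \<le> b" "strict_mono_on {a..b} \<sigma>" "continuous_on {a..b} \<sigma>"
  shows "\<sigma> ` {a..b} = {\<sigma> a..\<sigma> b}"
proof
  show "\<sigma> ` {a..b} \<subseteq> {\<sigma> a..\<sigma> b}"
    using assms(1) strict_mono_on_leD[OF assms(2)] by auto
  show "{\<sigma> a..\<sigma> b} \<subseteq> \<sigma> ` {a..b}"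
    using IVT'[of \<sigma> a _ b] assms(1,3) by force
qed

text \<open>Changes of parameter are found on the original curve, from \<open>{0..c}\<close> to
  \<open>{0..c'}\<close>; truncations live on \<open>{0..1}\<close>, hence the conjugation by
  scalings.\<close>

lemma reparam_rescale:
  fixes \<sigma> :: "real \<Rightarrow> real"
  assumes "0 < c" "0 < c'" "strict_mono_on {0..c} \<sigma>" "continuous_on {0..c} \<sigma>"
    "\<sigma> 0 = 0" "\<sigma> c = c'"
  shows "reparam (\<lambda>t. \<sigma> (c * t) / c')"
  unfolding reparam_def
proof
  have sub: "c * t \<in> {0..c}" if "t \<in> {0..1}" for t using that assms(1) by simp
  show *: "strict_mono_on {0..1} (\<lambda>t. \<sigma> (c * t) / c')"
    using assms sub by (auto intro!: strict_mono_onI divide_strict_right_mono strict_mono_onD[OF assms(3)])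
  have "continuous_on {0..1} (\<lambda>t. \<sigma> (c * t) / c')"
    using assms sub by (intro continuous_intros continuous_on_compose2[OF assms(4)]) auto
  from strict_mono_on_image_interval[OF zero_le_one * this]
  show "(\<lambda>t. \<sigma> (c * t) / c') ` {0..1} = {0..1}"
    using assms by simp
qed

lemma isolated_crossing:
  assumes D: "knotoid_diagram D"
  obtains \<delta> where "\<delta> > 0" "\<And>s t. crossing D s t \<Longrightarrow> \<bar>s - t0\<bar> \<le> \<delta> \<Longrightarrow> s = t0"
proof -
  obtain d where d: "d > 0" "\<forall>s\<in>{s. \<exists>t. crossing D s t}. s \<noteq> t0 \<longrightarrow> d \<le> dist t0 s"
    using finite_set_avoid[OF finite_crossing_parameters[OF D], of t0] by blast
  have "s = t0" if "crossing D s t" "\<bar>s - t0\<bar> \<le> d / 2" for s t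
  proof (rule ccontr)
    assume "s \<noteq> t0"
    with that d(2) have "d \<le> dist t0 s" by blast
    with that(2) d(1) show False unfolding dist_real_def by linarith
  qed
  thus thesis using that[of "d / 2"] d(1) by simp
qed

text \<open>The distance from \<open>p\<close> decreases strictly up to \<open>t0\<close> and
  increases strictly afterwards, so the level \<open>r\<close> is attained once on each side. This
  makes the part of a short arc inside a small cap a single interval whose ends alone meet the rim,
  as \<open>strand\<close> requires.\<close>

lemma distance_level_interval:
  assumes D: "knotoid_diagram D" and p: "curve D t0 = p" and \<delta>: "0 < \<delta>" "0 \<le> t0 - \<delta>" "t0 + \<delta> \<le> 1"
    and acute: "\<And>s t. s \<in> {0..1} \<Longrightarrow> t \<in> {0..1} \<Longrightarrow> \<bar>s - t0\<bar> \<le> \<delta> \<Longrightarrow> \<bar>t - t0\<bar> \<le> \<delta> \<Longrightarrow>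
       velocity D s \<bullet> velocity D t > 0"
    and r: "0 < r" "r < dist p (curve D (t0 - \<delta>))" "r < dist p (curve D (t0 + \<delta>))"
  obtains a b where "t0 - \<delta> < a" "a < t0" "t0 < b" "b < t0 + \<delta>"
    "\<And>t. t \<in> {t0-\<delta>..t0+\<delta>} \<Longrightarrow> dist p (curve D t) \<le> r \<longleftrightarrow> a \<le> t \<and> t \<le> b"
    "\<And>t. t \<in> {t0-\<delta>..t0+\<delta>} \<Longrightarrow> dist p (curve D t) = r \<longleftrightarrow> t = a \<or> t = b"
proof -
  let ?d = "\<lambda>t. dist p (curve D t)"
  have t0: "t0 \<in> {0..1}" using \<delta> by simp
  note mono = distance_from_crossing_monotone[OF D t0 acute, unfolded p]
  have right: "?d s < ?d t" if "t0 \<le> s" "s < t" "t \<le> t0 + \<delta>" for s t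
    by (rule mono(1)) (use that \<delta> in auto)
  have left: "?d t < ?d s" if "t0 - \<delta> \<le> s" "s < t" "t \<le> t0" for s t
    by (rule mono(2)) (use that \<delta> in auto)
  have cont: "continuous_on {0..1} ?d"
    using D by (intro continuous_intros continuous_on_curve) (simp add: knotoid_diagram_def)
  have "\<exists>a\<ge>t0-\<delta>. a \<le> t0 \<and> ?d a = r"
    using \<delta> r p by (intro IVT2' continuous_on_subset[OF cont]) auto
  then obtain a where a: "t0 - \<delta> \<le> a" "a \<le> t0" "?d a = r" by blast
  have "\<exists>b\<ge>t0. b \<le> t0+\<delta> \<and> ?d b = r"
    using \<delta> r p by (intro IVT' continuous_on_subset[OF cont]) auto
  then obtain b where b: "t0 \<le> b" "b \<le> t0 + \<delta>" "?d b = r" by blast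
  have ab: "t0 - \<delta> < a" "a < t0" "t0 < b" "b < t0 + \<delta>"
    using a b r p by (auto simp: less_le)
  have "(?d t \<le> r \<longleftrightarrow> a \<le> t \<and> t \<le> b) \<and> (?d t = r \<longleftrightarrow> t = a \<or> t = b)"
    if t: "t \<in> {t0-\<delta>..t0+\<delta>}" for t
  proof (cases "t \<le> t0")
    case True
    consider "t < a" | "t = a" | "a < t" by linarith
    thus ?thesis
      using left[of t a] left[of a t] t True a ab by cases auto
  next
    case False
    consider "t < b" | "t = b" | "b < t" by linarith
    thus ?thesis
      using right[of t b] right[of b t] t False b ab by cases auto
  qed
  with ab show thesis by (intro that) auto
qed

text \<open>A small enough cap about the crossing point meets the curve in exactly two arcs, around
  \<open>s0\<close> and around \<open>c0\<close>. Heads placed on the second arc before and after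
  \<open>c0\<close> give truncations that differ only inside the cap, where the longer one has the
  extra crossing. As \<open>s0 < c0\<close>, the arc around \<open>s0\<close> is present in
  both.\<close>

lemma Omega_v_at_crossing:
  assumes D: "knotoid_diagram D" and cross: "crossing D s0 c0" and less: "s0 < c0"
  obtains \<epsilon> where "\<epsilon> > 0"
    "\<And>c c'. c0 - \<epsilon> < c \<Longrightarrow> c < c0 \<Longrightarrow> c0 < c' \<Longrightarrow> c' < c0 + \<epsilon> \<Longrightarrow>
       Omega_v (trunc D c) (trunc D c')"
    "\<And>c. \<bar>c - c0\<bar> < \<epsilon> \<Longrightarrow> c \<noteq> c0 \<Longrightarrow> valid D c"
proof -
  let ?\<gamma> = "curve D"
  define p where "p = ?\<gamma> c0"
  note D' = D[unfolded knotoid_diagram_def]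
  have c0: "0 < c0" "c0 < 1" and s0: "0 < s0" "s0 < 1" "?\<gamma> s0 = p"
  proof -
    have "s0 \<in> {0..1}" "c0 \<in> {0..1}" and eq: "?\<gamma> s0 = p"
      using cross by (auto simp: crossing_def p_def)
    moreover have "s0 \<noteq> 0" "c0 \<noteq> 0" "s0 \<noteq> 1" "c0 \<noteq> 1"
      using D' cross crossing_sym[OF cross] by metis+
    ultimately show "0 < c0" "c0 < 1" "0 < s0" "s0 < 1" by auto
    show "?\<gamma> s0 = p" by (fact eq)
  qed
  have s0p: "p = ?\<gamma> s0" using s0 by simp
  have pS: "p \<in> S2" using D' c0 unfolding p_def by (simp add: image_subset_iff)
  have unique: "t = s0 \<or> t = c0" if "?\<gamma> t = p" "t \<in> {0..1}" for t
  proof (rule disjCI)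
    assume "t \<noteq> c0"
    with that c0 have "crossing D c0 t" by (auto simp: crossing_def p_def)
    with D' crossing_sym[OF cross] show "t = s0" by blast
  qed
  obtain \<delta>1 where \<delta>1: "\<delta>1 > 0"
    "\<And>s t. s \<in> {0..1} \<Longrightarrow> t \<in> {0..1} \<Longrightarrow> \<bar>s - s0\<bar> \<le> \<delta>1 \<Longrightarrow> \<bar>t - s0\<bar> \<le> \<delta>1 \<Longrightarrow>
       velocity D s \<bullet> velocity D t > 0"
    by (rule velocity_acute_nearby[OF D, of s0]) (use s0 in auto)
  obtain \<delta>2 where \<delta>2: "\<delta>2 > 0"
    "\<And>s t. s \<in> {0..1} \<Longrightarrow> t \<in> {0..1} \<Longrightarrow> \<bar>s - c0\<bar> \<le> \<delta>2 \<Longrightarrow> \<bar>t - c0\<bar> \<le> \<delta>2 \<Longrightarrow>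
       velocity D s \<bullet> velocity D t > 0"
    by (rule velocity_acute_nearby[OF D, of c0]) (use c0 in auto)
  obtain \<delta>3 where \<delta>3: "\<delta>3 > 0" "\<And>s t. crossing D s t \<Longrightarrow> \<bar>s - s0\<bar> \<le> \<delta>3 \<Longrightarrow> s = s0"
    using isolated_crossing[OF D] by blast
  obtain \<delta>4 where \<delta>4: "\<delta>4 > 0" "\<And>s t. crossing D s t \<Longrightarrow> \<bar>s - c0\<bar> \<le> \<delta>4 \<Longrightarrow> s = c0"
    using isolated_crossing[OF D] by blast
  \<comment> \<open>The last three bounds keep the windows around \<open>s0\<close> and
    \<open>c0\<close> inside the open unit interval and disjoint; the others make velocities acute
    and crossing parameters isolated in each window.\<close>
  define \<delta> where "\<delta> = Min {\<delta>1, \<delta>2, \<delta>3, \<delta>4, s0 / 2, (c0 - s0) / 3, (1 - c0) / 2}"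
  have "\<delta> > 0"
    unfolding \<delta>_def using \<delta>1(1) \<delta>2(1) \<delta>3(1) \<delta>4(1) s0 c0 less by (subst Min_gr_iff) auto
  moreover have "\<delta> \<le> \<delta>1" "\<delta> \<le> \<delta>2" "\<delta> \<le> \<delta>3" "\<delta> \<le> \<delta>4"
    "\<delta> \<le> s0 / 2" "\<delta> \<le> (c0 - s0) / 3" "\<delta> \<le> (1 - c0) / 2"
    unfolding \<delta>_def by (rule Min_le; simp)+
  ultimately have \<delta>: "\<delta> > 0" "\<delta> \<le> \<delta>1" "\<delta> \<le> \<delta>2" "\<delta> \<le> \<delta>3" "\<delta> \<le> \<delta>4"
    "\<delta> \<le> s0 / 2" "\<delta> \<le> (c0 - s0) / 3" "\<delta> \<le> (1 - c0) / 2" by blast+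
  have sep: "s0 + \<delta> < c0 - \<delta>" using \<delta>(1,7) by (simp add: field_simps)
  have isolated: "s = s0 \<or> s = c0"
    if "crossing D s t" "\<bar>s - s0\<bar> \<le> \<delta> \<or> \<bar>s - c0\<bar> \<le> \<delta>" for s t
    using that \<delta>3(2)[OF that(1)] \<delta>4(2)[OF that(1)] \<delta> by linarith
  \<comment> \<open>\<open>A\<close> is the curve outside two open windows. It is compact and misses
    \<open>p\<close>, which is attained only at \<open>s0\<close> and \<open>c0\<close>, so it stays
    at a positive distance. The window ends belong to \<open>A\<close>, which puts them outside the
    cap.\<close>
  define A where "A = {0..1} - ({s0-\<delta><..<s0+\<delta>} \<union> {c0-\<delta><..<c0+\<delta>})"
  have "compact A" unfolding A_def by (intro compact_diff open_Un) auto
  hence "closed (?\<gamma> ` A)"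
    using continuous_on_subset[OF continuous_on_curve, of D A] D'
    by (intro compact_imp_closed compact_continuous_image) (auto simp: A_def)
  moreover have "p \<notin> ?\<gamma> ` A"
    using unique \<delta>(1) by (fastforce simp: A_def)
  ultimately obtain m where m: "m > 0" "\<And>t. t \<in> A \<Longrightarrow> m \<le> dist p (?\<gamma> t)"
    using separate_point_closed[of "?\<gamma> ` A" p] by blast
  \<comment> \<open>Below \<open>m\<close> the cap misses \<open>A\<close>; below 1 the lemmas on
    round caps apply.\<close>
  define r where "r = min (m / 2) (1 / 2)"
  have r: "0 < r" "r < 1" "r < m" using m(1) by (auto simp: r_def)
  have far: "r < dist p (?\<gamma> t)" if "t \<in> A" for t using m(2)[OF that] r by linarith
  have ends: "s0 - \<delta> \<in> A" "s0 + \<delta> \<in> A" "c0 - \<delta> \<in> A" "c0 + \<delta> \<in> A"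
    using \<delta> s0 c0 less by (auto simp: A_def)
  obtain a1 b1 where J: "s0 - \<delta> < a1" "a1 < s0" "s0 < b1" "b1 < s0 + \<delta>"
    "\<And>t. t \<in> {s0-\<delta>..s0+\<delta>} \<Longrightarrow> dist p (?\<gamma> t) \<le> r \<longleftrightarrow> a1 \<le> t \<and> t \<le> b1"
    "\<And>t. t \<in> {s0-\<delta>..s0+\<delta>} \<Longrightarrow> dist p (?\<gamma> t) = r \<longleftrightarrow> t = a1 \<or> t = b1"
  proof (rule distance_level_interval[OF D s0(3) \<delta>(1)])
    show "0 \<le> s0 - \<delta>" "s0 + \<delta> \<le> 1"
      using \<delta>(1,6,7,8) s0(1) c0 less by (simp_all add: field_simps)
    show "0 < r" "r < dist p (?\<gamma> (s0 - \<delta>))" "r < dist p (?\<gamma> (s0 + \<delta>))"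
      using r far ends by blast+
    show "velocity D s \<bullet> velocity D t > 0"
      if "s \<in> {0..1}" "t \<in> {0..1}" "\<bar>s - s0\<bar> \<le> \<delta>" "\<bar>t - s0\<bar> \<le> \<delta>" for s t
      using that \<delta>1(2) \<delta> by simp
  qed blast
  obtain a2 b2 where I: "c0 - \<delta> < a2" "a2 < c0" "c0 < b2" "b2 < c0 + \<delta>"
    "\<And>t. t \<in> {c0-\<delta>..c0+\<delta>} \<Longrightarrow> dist p (?\<gamma> t) \<le> r \<longleftrightarrow> a2 \<le> t \<and> t \<le> b2"
    "\<And>t. t \<in> {c0-\<delta>..c0+\<delta>} \<Longrightarrow> dist p (?\<gamma> t) = r \<longleftrightarrow> t = a2 \<or> t = b2"
  proof (rule distance_level_interval[OF D p_def[symmetric] \<delta>(1)])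
    show "0 \<le> c0 - \<delta>" "c0 + \<delta> \<le> 1"
      using \<delta>(1,6,7,8) s0(1) c0 less by (simp_all add: field_simps)
    show "0 < r" "r < dist p (?\<gamma> (c0 - \<delta>))" "r < dist p (?\<gamma> (c0 + \<delta>))"
      using r far ends by blast+
    show "velocity D s \<bullet> velocity D t > 0"
      if "s \<in> {0..1}" "t \<in> {0..1}" "\<bar>s - c0\<bar> \<le> \<delta>" "\<bar>t - c0\<bar> \<le> \<delta>" for s t
      using that \<delta>2(2) \<delta> by simp
  qed blast
  have order: "0 < a1" "b1 < a2" "b2 < 1"
    using \<delta>(1,6,7,8) I(1-4) J(1-4) s0(1) c0 less by (simp_all add: field_simps)
  have near: "dist p (?\<gamma> t) \<le> r \<longleftrightarrow> t \<in> {a1..b1} \<or> t \<in> {a2..b2}"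
    and level: "dist p (?\<gamma> t) = r \<longleftrightarrow> t \<in> {a1, b1, a2, b2}" if "t \<in> {0..1}" for t
  proof -
    consider "t \<in> {s0-\<delta>..s0+\<delta>}" "t \<notin> {c0-\<delta>..c0+\<delta>}"
      | "t \<in> {c0-\<delta>..c0+\<delta>}" "t \<notin> {s0-\<delta>..s0+\<delta>}"
      | "t \<in> A" "t \<notin> {c0-\<delta>..c0+\<delta>}" "t \<notin> {s0-\<delta>..s0+\<delta>}"
    proof -
      have "t \<notin> {s0-\<delta>..s0+\<delta>} \<or> t \<notin> {c0-\<delta>..c0+\<delta>}" using sep by auto
      moreover have "t \<in> A \<or> t \<in> {s0-\<delta>..s0+\<delta>} \<or> t \<in> {c0-\<delta>..c0+\<delta>}"
        using \<open>t \<in> {0..1}\<close> unfolding A_def by auto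
      ultimately show thesis using that by blast
    qed
    hence "(dist p (?\<gamma> t) \<le> r \<longleftrightarrow> t \<in> {a1..b1} \<or> t \<in> {a2..b2}) \<and>
      (dist p (?\<gamma> t) = r \<longleftrightarrow> t \<in> {a1, b1, a2, b2})"
    proof cases
      case 1 thus ?thesis using J(5,6)[of t] I(1-4) sep by auto
    next
      case 2 thus ?thesis using I(5,6)[of t] J(1-4) sep by auto
    next
      case 3 thus ?thesis using far[of t] I(1-4) J(1-4) by auto
    qed
    thus "dist p (?\<gamma> t) \<le> r \<longleftrightarrow> t \<in> {a1..b1} \<or> t \<in> {a2..b2}"
      "dist p (?\<gamma> t) = r \<longleftrightarrow> t \<in> {a1, b1, a2, b2}" by auto
  qed
  have isolated': "s = s0 \<or> s = c0" if "crossing D s t" "s \<in> {a1..b1} \<or> s \<in> {a2..b2}" for s t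
    using isolated[OF that(1)] that(2) I(1-4) J(1-4) by (auto simp: abs_le_iff)
  have valid: "valid D c" if "a2 < c" "c < b2" "c \<noteq> c0" for c
    unfolding valid_def
  proof (intro allI impI notI)
    fix s assume "0 \<le> s \<and> s < c" "?\<gamma> s = ?\<gamma> c"
    hence "crossing D c s" using that I c0 order by (auto simp: crossing_def)
    from isolated'[OF this] that order I(1-4) J(1-4) show False by auto
  qed
  define B where "B = S2 \<inter> cball p r"
  have B: "closed_disc B" "bd B = S2 \<inter> sphere p r"
    unfolding B_def using closed_disc_cap bd_cap pS r by auto
  have inB: "?\<gamma> t \<in> B \<longleftrightarrow> t \<in> {a1..b1} \<or> t \<in> {a2..b2}"
    and inbd: "?\<gamma> t \<in> bd B \<longleftrightarrow> t \<in> {a1, b1, a2, b2}" if "t \<in> {0..1}" for t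
  proof -
    have "?\<gamma> t \<in> S2" using D' that by blast
    thus "?\<gamma> t \<in> B \<longleftrightarrow> t \<in> {a1..b1} \<or> t \<in> {a2..b2}"
      "?\<gamma> t \<in> bd B \<longleftrightarrow> t \<in> {a1, b1, a2, b2}"
      using near[OF that] level[OF that] unfolding B(2) by (simp_all add: B_def)
  qed
  have move: "Omega_v (trunc D c) (trunc D c')" if c: "a2 < c" "c < c0" "c0 < c'" "c' < b2" for c c'
  proof -
    have cpos: "0 < c" "0 < c'" "c \<le> 1" "c' \<le> 1" using c order I(1-4) J(1-4) by linarith+
    \<comment> \<open>\<open>\<sigma>\<close> is the identity up to the entry \<open>a2\<close> into
      the cap and stretches \<open>{a2..c}\<close> linearly onto \<open>{a2..c'}\<close>. Outside
      the cap both diagrams therefore agree pointwise.\<close>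
    define \<sigma> where "\<sigma> = (\<lambda>t. t + (c' - c) / (c - a2) * max 0 (t - a2))"
    define \<rho> where "\<rho> = (\<lambda>t. \<sigma> (c * t) / c')"
    have \<sigma>_id: "\<sigma> t = t" if "t \<le> a2" for t using that by (simp add: \<sigma>_def)
    have \<sigma>c: "\<sigma> c = c'" using c by (simp add: \<sigma>_def)
    have \<sigma>_less: "\<sigma> s < \<sigma> t" if "s < t" for s t
      unfolding \<sigma>_def using that c by (intro add_less_le_mono mult_left_mono) auto
    have \<sigma>_mid: "a2 < \<sigma> t" "\<sigma> t \<le> c'" if "a2 < t" "t \<le> c" for t
      using \<sigma>_less[of a2 t] \<sigma>_less[of t c] that \<sigma>_id[of a2] \<sigma>c by (auto simp: less_le)
    have \<rho>: "reparam \<rho>" unfolding \<rho>_def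
    proof (rule reparam_rescale[OF cpos(1,2)])
      show "strict_mono_on {0..c} \<sigma>" using \<sigma>_less by (simp add: strict_mono_on_def)
      show "continuous_on {0..c} \<sigma>"
        unfolding \<sigma>_def using c by (intro continuous_intros) auto
      show "\<sigma> 0 = 0" using \<sigma>_id order(1,2) J(1-4) by simp
    qed (fact \<sigma>c)
    have scaled: "c * t \<in> {0..1}" "c' * t \<in> {0..1}" if "t \<in> {0..1}" for t
      using that cpos by (simp_all add: mult_le_one)
    have scaled_le: "c * t \<le> c" if "t \<le> 1" for t using that cpos by simp
    have \<rho>01: "\<rho> t \<in> {0..1}" if "t \<in> {0..1}" for t using \<rho> that by (auto simp: reparam_def)
    have c\<rho>: "c' * \<rho> t = \<sigma> (c * t)" for t using cpos by (simp add: \<rho>_def)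
    \<comment> \<open>These are the two arcs in the parameters of the shorter truncation:
      \<open>?I\<close> contains its head, \<open>?J\<close> is the transversal strand.\<close>
    let ?I = "(a2 / c, 1)" and ?J = "(a1 / c, b1 / c)"
    have le_iff: "x / c \<le> t \<longleftrightarrow> x \<le> c * t" "t \<le> x / c \<longleftrightarrow> c * t \<le> x" for x t
      using cpos by (simp_all add: field_simps)
    have nonneg: "0 \<le> t" if "a1 \<le> c * t" for t
      using zero_less_mult_pos[of c t] that order(1) cpos(1) by linarith
    have ivlI: "ivl ?I = {t \<in> {0..1}. c * t \<in> {a2..b2}}"
    proof -
      have "c * t \<le> b2" if "t \<le> 1" for t
        using scaled_le[OF that] c by linarith
      moreover have "0 \<le> t" if "a2 \<le> c * t" for t
        by (rule nonneg) (use that order J(1-4) in linarith)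
      ultimately show ?thesis by (auto simp: le_iff)
    qed
    have ivlJ: "ivl ?J = {t \<in> {0..1}. c * t \<in> {a1..b1}}"
    proof -
      have "t \<le> 1" if "c * t \<le> b1" for t
      proof -
        have "c * t \<le> c" using that order c by linarith
        thus ?thesis using cpos by simp
      qed
      with nonneg show ?thesis by (auto simp: le_iff)
    qed
    have local: "local_change [?I, ?J] \<rho> (trunc D c) (trunc D c')"
      unfolding local_change_def
    proof (intro conjI exI[of _ B])
      show "knotoid_diagram (trunc D c)" "knotoid_diagram (trunc D c')"
        using knotoid_diagram_trunc[OF D] valid cpos c I(1-4) by auto
      show "reparam \<rho>" "closed_disc B" by (fact \<rho> B)+
      have "strand (trunc D c) B ?I"
        unfolding strand_def prod.case
      proof (intro conjI)
        show "0 \<le> a2 / c" "a2 / c < 1" using cpos c order I(1-4) J(1-4) by auto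
        show "curve (trunc D c) ` {a2 / c..1} \<subseteq> B"
        proof (rule image_subsetI)
          fix t assume "t \<in> {a2 / c..1}"
          hence "t \<in> ivl ?I" by simp
          hence "t \<in> {0..1}" "c * t \<in> {a2..b2}" unfolding ivlI by auto
          thus "curve (trunc D c) t \<in> B" using inB[OF scaled(1)] by simp
        qed
        \<comment> \<open>Only the entry meets the rim: the head stops before \<open>b2\<close>, so
          the parameter 1 is an end inside the disc.\<close>
        have "curve (trunc D c) t \<in> bd B \<longleftrightarrow> t = a2 / c" if "t \<in> {a2 / c..1}" for t
        proof -
          have "t \<in> ivl ?I" using that by simp
          hence t: "t \<in> {0..1}" "c * t \<in> {a2..b2}" unfolding ivlI by auto
          have "c * t < b2" using scaled_le[of t] t(1) c by auto
          hence "curve (trunc D c) t \<in> bd B \<longleftrightarrow> c * t = a2"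
            using inbd[OF scaled(1)[OF t(1)]] t(2) order I(1-4) J(1-4) c by auto
          thus ?thesis using cpos by (auto simp: field_simps)
        qed
        hence "{t \<in> {a2 / c..1}. curve (trunc D c) t \<in> bd B} = {t \<in> {a2 / c..1}. t = a2 / c}"
          by (rule Collect_cong[OF conj_cong[OF refl]])
        moreover have "{t \<in> {a2 / c..1}. t = a2 / c} = {a2 / c, 1} - {0, 1}"
        proof -
          have "0 < a2 / c" "a2 / c < 1" using cpos c order J(1-4) by auto
          thus ?thesis by auto
        qed
        ultimately show "{t \<in> {a2 / c..1}. curve (trunc D c) t \<in> bd B} = {a2 / c, 1} - {0, 1}"
          by (rule trans)
      qed simp
      moreover have "strand (trunc D c) B ?J"
        unfolding strand_def prod.case
      proof (intro conjI)
        show "0 \<le> a1 / c" "a1 / c < b1 / c" "b1 / c \<le> 1"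
          using cpos c order I(1-4) J(1-4) by (auto simp: divide_strict_right_mono)
        show "curve (trunc D c) ` {a1 / c..b1 / c} \<subseteq> B"
        proof (rule image_subsetI)
          fix t assume "t \<in> {a1 / c..b1 / c}"
          hence "t \<in> ivl ?J" by simp
          hence "t \<in> {0..1}" "c * t \<in> {a1..b1}" unfolding ivlJ by auto
          thus "curve (trunc D c) t \<in> B" using inB[OF scaled(1)] by simp
        qed
        have "curve (trunc D c) t \<in> bd B \<longleftrightarrow> t = a1 / c \<or> t = b1 / c" if "t \<in> {a1 / c..b1 / c}" for t
        proof -
          have "t \<in> ivl ?J" using that by simp
          hence t: "t \<in> {0..1}" "c * t \<in> {a1..b1}" unfolding ivlJ by auto
          hence "curve (trunc D c) t \<in> bd B \<longleftrightarrow> c * t = a1 \<or> c * t = b1"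
            using inbd[OF scaled(1)[OF t(1)]] order I(1-4) J(1-4) by auto
          thus ?thesis using cpos by (auto simp: field_simps)
        qed
        hence "{t \<in> {a1 / c..b1 / c}. curve (trunc D c) t \<in> bd B} =
            {t \<in> {a1 / c..b1 / c}. t = a1 / c \<or> t = b1 / c}"
          by (rule Collect_cong[OF conj_cong[OF refl]])
        moreover have "{t \<in> {a1 / c..b1 / c}. t = a1 / c \<or> t = b1 / c} = {a1 / c, b1 / c} - {0, 1}"
        proof -
          have "0 < a1 / c" "a1 / c < b1 / c" "b1 / c < 1"
            using cpos c order I(1-4) J(1-4) by (auto simp: divide_strict_right_mono)
          thus ?thesis by auto
        qed
        ultimately show "{t \<in> {a1 / c..b1 / c}. curve (trunc D c) t \<in> bd B} = {a1 / c, b1 / c} - {0, 1}"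
          by (rule trans)
      qed
      ultimately show "\<forall>K\<in>set [?I, ?J]. strand (trunc D c) B K" by simp
      have "ivl ?I \<inter> ivl ?J = {}"
        unfolding ivlI ivlJ using order by auto
      thus "disjoint_family_on (\<lambda>i. ivl ([?I, ?J] ! i)) {..<length [?I, ?J]}"
        by (auto simp: disjoint_family_on_def less_Suc_eq numeral_2_eq_2)
      show "{t \<in> {0..1}. curve (trunc D c) t \<in> B} = (\<Union>K\<in>set [?I, ?J]. ivl K)"
        using inB scaled(1) by (auto simp add: ivlI ivlJ simp del: fst_conv snd_conv)
      show "inj_on (curve (trunc D c)) {t \<in> {0..1}. curve (trunc D c) t \<in> bd B}"
      proof (rule inj_onI, rule ccontr)
        fix s t
        assume st: "s \<in> {t \<in> {0..1}. curve (trunc D c) t \<in> bd B}"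
          "t \<in> {t \<in> {0..1}. curve (trunc D c) t \<in> bd B}"
          "curve (trunc D c) s = curve (trunc D c) t" "s \<noteq> t"
        hence cs: "c * s \<in> {a1, b1, a2, b2}" using inbd[OF scaled(1), of s] by auto
        have "crossing D (c * s) (c * t)"
          using st scaled(1)[of s] scaled(1)[of t] cpos by (auto simp: crossing_def)
        from isolated'[OF this] cs show False using order I(1-4) J(1-4) by auto
      qed
      \<comment> \<open>After \<open>a2\<close> the shorter curve stays in the interior of the cap,
        so every point outside that interior is in the range where \<open>\<sigma>\<close> is the
        identity.\<close>
      have \<sigma>_far: "c * t \<le> a2" if "t \<in> {0..1}" "?\<gamma> (c * t) \<notin> B - bd B" for t
      proof (rule ccontr)
        assume "\<not> c * t \<le> a2"
        moreover have "c * t < b2" using scaled_le[of t] that c by auto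
        ultimately show False
          using inB[OF scaled(1)[OF that(1)]] inbd[OF scaled(1)[OF that(1)]] that(2) c order J(1-4) by auto
      qed
      show "\<forall>t\<in>{0..1}. curve (trunc D c) t \<in> B - bd B \<longleftrightarrow> curve (trunc D c') (\<rho> t) \<in> B - bd B"
      proof
        fix t :: real assume t: "t \<in> {0..1}"
        show "curve (trunc D c) t \<in> B - bd B \<longleftrightarrow> curve (trunc D c') (\<rho> t) \<in> B - bd B"
        proof (cases "c * t \<le> a2")
          case True
          thus ?thesis by (simp add: c\<rho> \<sigma>_id)
        next
          case False
          have mid: "a2 < \<sigma> (c * t)" "\<sigma> (c * t) \<le> c'"
            using \<sigma>_mid[OF _ scaled_le] False t by auto
          have "?\<gamma> (c * t) \<in> B - bd B" using \<sigma>_far[OF t] False by blast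
          moreover have "\<sigma> (c * t) \<in> {0..1}" using scaled(2)[OF \<rho>01[OF t]] by (simp add: c\<rho>)
          hence "?\<gamma> (\<sigma> (c * t)) \<in> B - bd B"
            using mid inB[of "\<sigma> (c * t)"] inbd[of "\<sigma> (c * t)"] c order J(1-4) by auto
          ultimately show ?thesis by (simp add: c\<rho>)
        qed
      qed
      show "\<forall>t\<in>{0..1}. curve (trunc D c) t \<notin> B - bd B \<longrightarrow>
          curve (trunc D c') (\<rho> t) = curve (trunc D c) t \<and>
          (t \<in> overs (trunc D c) \<longleftrightarrow> \<rho> t \<in> overs (trunc D c'))"
        using \<sigma>_far by (simp add: c\<rho> \<sigma>_id)
    qed
    let ?s = "c0 / c'" and ?t = "s0 / c'"
    have in_strand: "c' * x \<in> {a1..b1} \<or> c' * x \<in> {a2..b2}"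
      if x: "x \<in> \<rho> ` (ivl ?I \<union> ivl ?J)" for x
    proof -
      obtain u where u: "x = \<rho> u" "u \<in> {0..1}" "c * u \<in> {a1..b1} \<or> c * u \<in> {a2..b2}"
        using x unfolding ivlI ivlJ by blast
      show ?thesis
      proof (cases "c * u \<le> a2")
        case True
        thus ?thesis using u(3) \<sigma>_id[OF True] unfolding u(1) c\<rho> by simp
      next
        case False
        hence "a2 < \<sigma> (c * u)" "\<sigma> (c * u) \<le> c'"
          using \<sigma>_mid[OF _ scaled_le] u(2) by auto
        thus ?thesis using c unfolding u(1) c\<rho> by auto
      qed
    qed
    have crossE': "crossing (trunc D c') ?s ?t"
      using crossing_sym[OF cross] cpos c c0 s0 less by (simp add: crossing_trunc)
    obtain u where u: "u \<in> {0..1}" "\<rho> u = ?s"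
    proof -
      have "?s \<in> {0..1}" using c c0 by simp
      with \<rho> show thesis using that unfolding reparam_def by (metis imageE)
    qed
    have s: "?s \<in> \<rho> ` ivl ?I"
    proof -
      have "\<sigma> (c * u) = c0" using c\<rho>[of u] u(2) cpos by simp
      hence "a2 \<le> c * u" using \<sigma>_id[of "c * u"] I by linarith
      moreover have "c * u \<le> b2" using scaled_le[of u] u(1) c by auto
      ultimately have "u \<in> ivl ?I" using u(1) c unfolding ivlI by auto
      thus ?thesis using u(2) by force
    qed
    have t: "?t \<in> \<rho> ` ivl ?J"
    proof
      show "s0 / c \<in> ivl ?J" using J cpos by (simp add: divide_right_mono)
      show "?t = \<rho> (s0 / c)" using \<sigma>_id[of s0] J order cpos by (simp add: \<rho>_def)
    qed
    show ?thesis
      unfolding end_move_def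
    proof (rule exI[of _ ?I], rule exI[of _ ?J], rule exI[of _ \<rho>],
        intro conjI bexI[OF _ s] bexI[OF _ t])
      show "local_change [?I, ?J] \<rho> (trunc D c) (trunc D c')" by (fact local)
      show "0 < fst ?J" "snd ?J < 1" using order c I(1-4) cpos by simp_all
      show "fst ?I = 0 \<and> snd ?I < 1 \<or> 0 < fst ?I \<and> snd ?I = 1"
        using order I(1-4) J(1-4) cpos by simp
      \<comment> \<open>Inside the cap only \<open>s0\<close> and \<open>c0\<close> are crossing
        parameters, and the shorter head has not reached \<open>c0\<close>; both branches would have
        to be at \<open>s0\<close>.\<close>
      have "\<not> crossing (trunc D c) x y" if "x \<in> ivl ?I \<union> ivl ?J" "y \<in> ivl ?I \<union> ivl ?J" for x y
      proof
        assume xy: "crossing (trunc D c) x y"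
        hence D_xy: "crossing D (c * x) (c * y)" using crossing_trunc cpos by blast
        have "c * x \<le> c" "c * y \<le> c" using xy scaled_le by (auto simp: crossing_def)
        moreover have "c * x = s0 \<or> c * x = c0" "c * y = s0 \<or> c * y = c0"
          using that isolated'[OF D_xy] isolated'[OF crossing_sym[OF D_xy]]
          unfolding ivlI ivlJ by auto
        ultimately have "c * x = c * y" using c by linarith
        with D_xy show False by (simp add: crossing_def)
      qed
      thus "crossings_in (trunc D c) (ivl ?I \<union> ivl ?J) = {}"
        unfolding crossings_in_def by blast
      show "crosses (trunc D c') Virtual ?s ?t"
        using crossE' by (simp add: crosses_def)
      have "{x, y} = {?s, ?t}"
        if "x \<in> \<rho> ` (ivl ?I \<union> ivl ?J)" "y \<in> \<rho> ` (ivl ?I \<union> ivl ?J)" "crossing (trunc D c') x y" for x y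
      proof -
        have D_xy: "crossing D (c' * x) (c' * y)" using that crossing_trunc cpos by blast
        have "x = ?s \<or> x = ?t" "y = ?s \<or> y = ?t"
          using isolated'[OF D_xy in_strand[OF that(1)]]
            isolated'[OF crossing_sym[OF D_xy] in_strand[OF that(2)]] cpos
          by (auto simp: field_simps)
        moreover have "x \<noteq> y" using that by (simp add: crossing_def)
        ultimately show ?thesis by auto
      qed
      moreover have "?s \<in> \<rho> ` (ivl ?I \<union> ivl ?J)" "?t \<in> \<rho> ` (ivl ?I \<union> ivl ?J)"
        using s t by blast+
      ultimately show "crossings_in (trunc D c') (\<rho> ` (ivl ?I \<union> ivl ?J)) = {{?s, ?t}}"
        unfolding crossings_in_def using crossE' by blast
    qed
  qed
  define \<epsilon> where "\<epsilon> = min (c0 - a2) (b2 - c0)"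
  show thesis
  proof (rule that[of \<epsilon>])
    show "\<epsilon> > 0" using I by (simp add: \<epsilon>_def)
  qed (auto intro!: move valid simp: \<epsilon>_def)
qed

subsection \<open>Pulling the head back along an arc without crossings\<close>

text \<open>The constant function \<open>curve D t \<bullet> curve D t\<close> has derivative
  zero.\<close>

lemma velocity_tangent:
  assumes D: "knotoid_diagram D" and t: "t \<in> {0..1}"
  shows "curve D t \<bullet> velocity D t = 0"
proof -
  have smooth: "smooth_curve (curve D)" and S: "\<And>t. t \<in> {0..1} \<Longrightarrow> norm (curve D t) = 1"
    using D by (simp_all add: knotoid_diagram_def image_subset_iff)
  have d1: "((\<lambda>t. curve D t \<bullet> curve D t) has_vector_derivative 2 * (curve D t \<bullet> velocity D t))
    (at t within {0..1})"
    using has_velocity[OF smooth t] unfolding has_vector_derivative_def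
    by (auto intro!: derivative_eq_intros simp: inner_commute)
  have d2: "((\<lambda>t. curve D t \<bullet> curve D t) has_vector_derivative 0) (at t within {0..1})"
    by (rule has_vector_derivative_transform[OF t _ has_vector_derivative_const[of 1]])
      (use S in \<open>simp add: norm_eq_1\<close>)
  have "2 * (curve D t \<bullet> velocity D t) = 0"
    using vector_derivative_unique_within_closed_interval
      [OF zero_less_one _ d1[folded cbox_interval] d2[folded cbox_interval]] t by simp
  thus ?thesis by simp
qed

text \<open>A motion of a compact chart domain that fixes its rim is transported to the sphere and
  continued by the identity. Openness of the image of the interior makes its complement closed, so
  that the two definitions can be pasted continuously.\<close>

lemma isotopy_extended_by_identity:
  fixes \<Psi> :: "'a::euclidean_space \<Rightarrow> real^3" and G :: "real \<Rightarrow> 'a \<Rightarrow> 'a"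
  assumes Q: "compact Q" and \<Psi>: "continuous_on Q \<Psi>" "inj_on \<Psi> Q" "\<Psi> ` Q \<subseteq> S2"
    and op: "openin (top_of_set S2) (\<Psi> ` interior Q)"
    and cont: "continuous_on ({0..1} \<times> Q) (\<lambda>(\<tau>, z). G \<tau> z)"
    and bij: "\<And>\<tau>. \<tau> \<in> {0..1} \<Longrightarrow> bij_betw (G \<tau>) Q Q"
    and rim: "\<And>\<tau> z. \<tau> \<in> {0..1} \<Longrightarrow> z \<in> Q - interior Q \<Longrightarrow> G \<tau> z = z"
    and start: "\<And>z. z \<in> Q \<Longrightarrow> G 0 z = z"
  obtains h where "homotopic_with_canon (\<lambda>g. \<exists>g'. homeomorphism S2 S2 g g') S2 S2 id h"
    "\<And>z. z \<in> Q \<Longrightarrow> h (\<Psi> z) = \<Psi> (G 1 z)" "\<And>q. q \<in> S2 - \<Psi> ` interior Q \<Longrightarrow> h q = q"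
proof -
  define K where "K = \<Psi> ` Q"
  obtain \<Psi>' where "homeomorphism Q K \<Psi> \<Psi>'"
    using homeomorphism_compact[OF Q \<Psi>(1) _ \<Psi>(2)] K_def by blast
  hence \<Psi>': "continuous_on K \<Psi>'" "\<Psi>' ` K = Q" "\<And>z. z \<in> Q \<Longrightarrow> \<Psi>' (\<Psi> z) = z"
    "\<And>q. q \<in> K \<Longrightarrow> \<Psi> (\<Psi>' q) = q"
    by (auto simp: homeomorphism_def)
  define H where "H = (\<lambda>\<tau> q. if q \<in> K then \<Psi> (G \<tau> (\<Psi>' q)) else q)"
  have K: "compact K" "K \<subseteq> S2" using compact_continuous_image[OF \<Psi>(1) Q] \<Psi>(3) K_def by auto
  have GQ: "G \<tau> z \<in> Q" if "\<tau> \<in> {0..1}" "z \<in> Q" for \<tau> z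
    using bij[OF that(1)] that(2) by (auto simp: bij_betw_def)
  have H_\<Psi>: "H \<tau> (\<Psi> z) = \<Psi> (G \<tau> z)" if "z \<in> Q" for \<tau> z
    using that \<Psi>'(3) by (simp add: H_def K_def)
  have H_id: "H \<tau> q = q" if "\<tau> \<in> {0..1}" "q \<notin> \<Psi> ` interior Q" for \<tau> q
  proof (cases "q \<in> K")
    case True
    then obtain z where z: "z \<in> Q" "q = \<Psi> z" by (auto simp: K_def)
    hence "z \<in> Q - interior Q" using that by blast
    thus ?thesis using H_\<Psi> rim that z by simp
  qed (simp add: H_def)
  obtain W where W: "open W" "\<Psi> ` interior Q = S2 \<inter> W"
    using op by (auto simp: openin_open)
  \<comment> \<open>The two closed pieces overlap only over the image of the rim of
    \<open>Q\<close>, where \<open>G\<close> is the identity.\<close>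
  have "continuous_on ({0..1} \<times> K \<union> {0..1} \<times> (S2 - W))
      (\<lambda>x. if snd x \<in> K then (\<lambda>(\<tau>, q). \<Psi> (G \<tau> (\<Psi>' q))) x else snd x)"
  proof (rule continuous_on_cases)
    show "closed ({0..1::real} \<times> K)"
      using K by (intro closed_Times) (auto intro: compact_imp_closed)
    show "closed ({0..1::real} \<times> (S2 - W))"
      using W by (intro closed_Times closed_Diff) auto
    have "continuous_on ({0..1} \<times> K) (\<lambda>x. (fst x, \<Psi>' (snd x)))"
      by (intro continuous_intros continuous_on_compose2[OF \<Psi>'(1)]) auto
    hence "continuous_on ({0..1} \<times> K) (\<lambda>x. (\<lambda>(\<tau>, z). G \<tau> z) (fst x, \<Psi>' (snd x)))"
      by (rule continuous_on_compose2[OF cont]) (use \<Psi>'(2) in auto)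
    hence "continuous_on ({0..1} \<times> K) (\<lambda>x. \<Psi> ((\<lambda>(\<tau>, z). G \<tau> z) (fst x, \<Psi>' (snd x))))"
      by (rule continuous_on_compose2[OF \<Psi>(1)]) (use GQ \<Psi>'(2) in force)
    thus "continuous_on ({0..1} \<times> K) (\<lambda>(\<tau>, q). \<Psi> (G \<tau> (\<Psi>' q)))"
      by (simp add: case_prod_beta)
    show "\<forall>x. x \<in> {0..1} \<times> K \<and> snd x \<notin> K \<or> x \<in> {0..1} \<times> (S2 - W) \<and> snd x \<in> K \<longrightarrow>
        (\<lambda>(\<tau>, q). \<Psi> (G \<tau> (\<Psi>' q))) x = snd x"
    proof (intro allI impI)
      fix x :: "real \<times> (real^3)"
      assume "x \<in> {0..1} \<times> K \<and> snd x \<notin> K \<or> x \<in> {0..1} \<times> (S2 - W) \<and> snd x \<in> K"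
      hence x: "fst x \<in> {0..1}" "snd x \<in> S2 - W" "snd x \<in> K" by auto
      hence "H (fst x) (snd x) = snd x" using W(2) by (intro H_id) auto
      thus "(\<lambda>(\<tau>, q). \<Psi> (G \<tau> (\<Psi>' q))) x = snd x"
        using x(3) by (simp add: H_def case_prod_beta)
    qed
  qed (intro continuous_intros)
  moreover have "{0..1::real} \<times> K \<union> {0..1} \<times> (S2 - W) = {0..1} \<times> S2"
  proof -
    have "S2 \<inter> W \<subseteq> K" unfolding W(2)[symmetric] K_def using interior_subset by (rule image_mono)
    hence "K \<union> (S2 - W) = S2" using K(2) by blast
    thus ?thesis by (simp only: Sigma_Un_distrib2[symmetric])
  qed
  ultimately have H_cont: "continuous_on ({0..1} \<times> S2) (\<lambda>x. H (fst x) (snd x))"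
    unfolding H_def case_prod_unfold by simp
  have H_bij: "bij_betw (H \<tau>) S2 S2" if \<tau>: "\<tau> \<in> {0..1}" for \<tau>
  proof -
    have "bij_betw \<Psi>' K Q"
      using \<Psi>'(2,4) by (auto simp: bij_betw_def intro: inj_on_inverseI)
    moreover have "bij_betw \<Psi> Q K" using \<Psi>(2) by (simp add: bij_betw_def K_def)
    ultimately have "bij_betw (\<Psi> \<circ> (G \<tau> \<circ> \<Psi>')) K K"
      using bij[OF \<tau>] by (blast intro: bij_betw_trans)
    hence "bij_betw (H \<tau>) K K"
      by (rule bij_betw_cong[THEN iffD1, rotated]) (simp add: H_def)
    moreover have "bij_betw (H \<tau>) (S2 - K) (S2 - K)"
      by (rule bij_betw_cong[THEN iffD1, rotated, OF bij_betw_id]) (simp add: H_def)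
    ultimately have "bij_betw (H \<tau>) (K \<union> (S2 - K)) (K \<union> (S2 - K))"
      by (rule bij_betw_combine) auto
    moreover have "K \<union> (S2 - K) = S2" using K(2) by auto
    ultimately show ?thesis by simp
  qed
  \<comment> \<open>On a compact set a continuous bijection is a homeomorphism, so the inverses need
    no formula.\<close>
  have H_homeo: "\<exists>g'. homeomorphism S2 S2 (H \<tau>) g'" if \<tau>: "\<tau> \<in> {0..1}" for \<tau>
  proof (rule homeomorphism_compact)
    have "continuous_on S2 (\<lambda>q. (\<lambda>x. H (fst x) (snd x)) (\<tau>, q))"
      by (rule continuous_on_compose2[OF H_cont]) (use \<tau> in \<open>auto intro!: continuous_intros\<close>)
    thus "continuous_on S2 (H \<tau>)" by simp
    show "H \<tau> ` S2 = S2" "inj_on (H \<tau>) S2" using H_bij[OF \<tau>] by (auto simp: bij_betw_def)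
  qed simp
  show thesis
  proof
    show "homotopic_with_canon (\<lambda>g. \<exists>g'. homeomorphism S2 S2 g g') S2 S2 id (H 1)"
      unfolding homotopic_with_def
    proof (intro exI[of _ "\<lambda>x. H (fst x) (snd x)"] conjI allI ballI)
      have "H \<tau> q \<in> S2" if "\<tau> \<in> {0..1}" "q \<in> S2" for \<tau> q
        using H_bij[OF that(1)] that(2) unfolding bij_betw_def by blast
      thus "continuous_map (prod_topology (top_of_set {0..1}) (top_of_set S2)) (top_of_set S2)
          (\<lambda>x. H (fst x) (snd x))"
        using H_cont by (auto simp flip: subtopology_Times simp: euclidean_product_topology)
      show "H (fst (0, q)) (snd (0, q)) = id q" for q
        using \<Psi>'(2,4) start by (auto simp: H_def)
      show "\<exists>g'. homeomorphism S2 S2 (\<lambda>q. H (fst (\<tau>, q)) (snd (\<tau>, q))) g'"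
        if "\<tau> \<in> {0..1}" for \<tau> using H_homeo[OF that] by simp
    qed simp
    show "\<And>z. z \<in> Q \<Longrightarrow> H 1 (\<Psi> z) = \<Psi> (G 1 z)" by (fact H_\<Psi>)
    show "\<And>q. q \<in> S2 - \<Psi> ` interior Q \<Longrightarrow> H 1 q = q" using H_id by simp
  qed
qed

section \<open>Sliding along the axis of a rectangle\<close>

text \<open>The tent function of height \<open>d\<close> over \<open>t0\<close> is 1-Lipschitz, so
  subtracting a multiple with factor below 1 in absolute value cannot reverse the order.\<close>

lemma slide_strict_mono:
  fixes \<nu> d t0 :: real
  assumes "\<bar>\<nu>\<bar> < 1" "s < t"
  shows "s - \<nu> * max 0 (d - \<bar>s - t0\<bar>) < t - \<nu> * max 0 (d - \<bar>t - t0\<bar>)"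
proof -
  define A where "A = max 0 (d - \<bar>t - t0\<bar>) - max 0 (d - \<bar>s - t0\<bar>)"
  have "\<bar>A\<bar> \<le> t - s" using assms(2) unfolding A_def by linarith
  hence "\<bar>\<nu> * A\<bar> < t - s"
  proof (cases "A = 0")
    case False
    hence "\<bar>\<nu>\<bar> * \<bar>A\<bar> < 1 * \<bar>A\<bar>" using assms(1) by (intro mult_strict_right_mono) auto
    thus ?thesis using \<open>\<bar>A\<bar> \<le> t - s\<close> unfolding abs_mult by linarith
  qed (use assms in simp)
  thus ?thesis by (simp add: A_def algebra_simps)
qed

lemma slide_bij:
  fixes \<nu> d t0 :: real
  assumes "\<bar>\<nu>\<bar> < 1" "0 < d"
  shows "bij_betw (\<lambda>t. t - \<nu> * max 0 (d - \<bar>t - t0\<bar>)) {t0-d..t0+d} {t0-d..t0+d}"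
proof -
  let ?f = "\<lambda>t. t - \<nu> * max 0 (d - \<bar>t - t0\<bar>)"
  have mono: "strict_mono_on {t0-d..t0+d} ?f"
    using slide_strict_mono[OF assms(1)] by (simp add: strict_mono_on_def)
  moreover have "continuous_on {t0-d..t0+d} ?f"
    by (intro continuous_intros)
  ultimately have "?f ` {t0-d..t0+d} = {?f (t0-d)..?f (t0+d)}"
    using assms(2) by (intro strict_mono_on_image_interval) auto
  also have "\<dots> = {t0-d..t0+d}" using assms(2) by simp
  finally show ?thesis
    using strict_mono_on_imp_inj_on[OF mono] by (simp add: bij_betw_def)
qed

text \<open>Each horizontal line is mapped to itself by a slide whose strength fades linearly to
  zero at height \<open>d\<close>. The tent function vanishes on the vertical sides, so the whole
  rim stays fixed; on the axis at time 1 the slide has full strength \<open>\<mu>\<close>.\<close>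

lemma slide_rectangle:
  fixes \<mu> d t0 :: real
  assumes \<mu>: "\<bar>\<mu>\<bar> < 1" and d: "0 < d"
  defines "G \<equiv> \<lambda>\<tau> (t, w). (t - \<tau> * \<mu> * (1 - \<bar>w\<bar> / d) * max 0 (d - \<bar>t - t0\<bar>), w)"
    and "Q \<equiv> cbox (t0 - d, - d) (t0 + d, d)"
  shows "continuous_on ({0..1} \<times> Q) (\<lambda>(\<tau>, z). G \<tau> z)"
    and "\<And>\<tau>. \<tau> \<in> {0..1} \<Longrightarrow> bij_betw (G \<tau>) Q Q"
    and "\<And>\<tau> z. \<tau> \<in> {0..1} \<Longrightarrow> z \<in> Q - interior Q \<Longrightarrow> G \<tau> z = z"
    and "\<And>z. z \<in> Q \<Longrightarrow> G 0 z = z"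
proof -
  have Q: "Q = {t0-d..t0+d} \<times> {-d..d}" by (simp add: Q_def cbox_Pair_eq)
  show "continuous_on ({0..1} \<times> Q) (\<lambda>(\<tau>, z). G \<tau> z)"
    using d unfolding G_def case_prod_beta by (intro continuous_intros) auto
  show "bij_betw (G \<tau>) Q Q" if \<tau>: "\<tau> \<in> {0..1}" for \<tau>
  proof -
    have slide: "bij_betw (\<lambda>t. t - \<tau> * \<mu> * (1 - \<bar>w\<bar> / d) * max 0 (d - \<bar>t - t0\<bar>))
        {t0-d..t0+d} {t0-d..t0+d}" if w: "w \<in> {-d..d}" for w
    proof (rule slide_bij[OF _ d])
      have "0 \<le> \<tau> * (1 - \<bar>w\<bar> / d)" "\<tau> * (1 - \<bar>w\<bar> / d) \<le> 1"
      proof -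
        have "0 \<le> 1 - \<bar>w\<bar> / d" "1 - \<bar>w\<bar> / d \<le> 1" using w d by (auto simp: abs_le_iff)
        thus "0 \<le> \<tau> * (1 - \<bar>w\<bar> / d)" "\<tau> * (1 - \<bar>w\<bar> / d) \<le> 1"
          using \<tau> by (simp_all add: mult_le_one)
      qed
      hence "\<bar>\<mu>\<bar> * (\<tau> * (1 - \<bar>w\<bar> / d)) \<le> \<bar>\<mu>\<bar>" by (intro mult_left_le) auto
      thus "\<bar>\<tau> * \<mu> * (1 - \<bar>w\<bar> / d)\<bar> < 1"
        using \<mu> \<open>0 \<le> \<tau> * (1 - \<bar>w\<bar> / d)\<close>
        by (metis (no_types, opaque_lifting) abs_mult abs_of_nonneg le_less_trans mult.commute mult.left_commute)
    qed
    show ?thesis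
      unfolding bij_betw_def
    proof
      show "inj_on (G \<tau>) Q"
      proof (rule inj_onI)
        fix z z' assume z: "z \<in> Q" "z' \<in> Q" "G \<tau> z = G \<tau> z'"
        obtain t w t' w' where tw: "z = (t, w)" "z' = (t', w')" by fastforce
        hence "w' = w" "w \<in> {-d..d}" "t \<in> {t0-d..t0+d}" "t' \<in> {t0-d..t0+d}"
          using z by (auto simp: Q G_def)
        with z(3) tw inj_onD[OF bij_betw_imp_inj_on[OF slide], of w t t'] show "z = z'"
          by (simp add: G_def)
      qed
      show "G \<tau> ` Q = Q"
      proof
        show "G \<tau> ` Q \<subseteq> Q"
        proof (rule image_subsetI)
          fix z assume z: "z \<in> Q"
          obtain t w where tw: "z = (t, w)" by fastforce
          hence "w \<in> {-d..d}" "t \<in> {t0-d..t0+d}" using z by (auto simp: Q)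
          thus "G \<tau> z \<in> Q"
            using bij_betwE[OF slide, of w] unfolding tw Q G_def by simp
        qed
        show "Q \<subseteq> G \<tau> ` Q"
        proof
          fix z assume "z \<in> Q"
          then obtain t w where z: "z = (t, w)" "t \<in> {t0-d..t0+d}" "w \<in> {-d..d}"
            unfolding Q by blast
          then obtain s where "s \<in> {t0-d..t0+d}"
            "t = s - \<tau> * \<mu> * (1 - \<bar>w\<bar> / d) * max 0 (d - \<bar>s - t0\<bar>)"
            using slide[OF z(3), THEN bij_betw_imp_surj_on] by blast
          thus "z \<in> G \<tau> ` Q"
            using z unfolding Q G_def by (intro image_eqI[of _ _ "(s, w)"]) auto
        qed
      qed
    qed
  qed
  show "G \<tau> z = z" if "\<tau> \<in> {0..1}" "z \<in> Q - interior Q" for \<tau> z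
  proof -
    obtain t w where z: "z = (t, w)" by fastforce
    have "t \<in> {t0-d..t0+d}" "w \<in> {-d..d}" using that z unfolding Q by auto
    moreover have "\<not> (t0 - d < t \<and> t < t0 + d \<and> - d < w \<and> w < d)"
      using that unfolding Q_def z by (auto simp: mem_box Basis_prod_def)
    ultimately have "\<bar>w\<bar> = d \<or> \<bar>t - t0\<bar> = d" by auto
    thus ?thesis using d unfolding G_def z by auto
  qed
  show "G 0 z = z" if "z \<in> Q" for z
    by (simp add: G_def case_prod_beta)
qed

section \<open>Straightening the curve in a chart of the sphere\<close>

text \<open>The remainder of the expansion is orthogonal to \<open>p\<close>, \<open>e\<close> and
  \<open>n\<close>. By the triple product formula its cross product with \<open>n\<close> vanishes
  as well, and a vector both orthogonal and parallel to the unit vector \<open>n\<close> is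
  zero.\<close>

lemma orthonormal_frame_expand:
  fixes p e q :: "real^3"
  assumes "norm p = 1" "norm e = 1" "p \<bullet> e = 0"
  defines "n \<equiv> cross3 p e"
  shows "q = (q \<bullet> e) *\<^sub>R e + (q \<bullet> n) *\<^sub>R n + (q \<bullet> p) *\<^sub>R p"
    and "n \<bullet> n = 1" "n \<bullet> p = 0" "n \<bullet> e = 0"
proof -
  have pe: "p \<bullet> p = 1" "e \<bullet> e = 1" "e \<bullet> p = 0" using assms by (simp_all add: norm_eq_1 inner_commute)
  show n: "n \<bullet> n = 1" "n \<bullet> p = 0" "n \<bullet> e = 0"
    using norm_cross[of p e] assms(1-3)
    by (simp_all add: n_def dot_cross_self norm_eq_1 power2_norm_eq_inner)
  define r where "r = q - ((q \<bullet> e) *\<^sub>R e + (q \<bullet> n) *\<^sub>R n + (q \<bullet> p) *\<^sub>R p)"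
  have r: "r \<bullet> e = 0" "r \<bullet> p = 0" "r \<bullet> n = 0"
    using pe n by (simp_all add: r_def inner_diff inner_add inner_commute)
  have "cross3 r n = 0"
    using r unfolding n_def Lagrange by simp
  hence "norm r = 0"
    using norm_and_cross_eq_0[of r n] r(3) n(1) by auto
  thus "q = (q \<bullet> e) *\<^sub>R e + (q \<bullet> n) *\<^sub>R n + (q \<bullet> p) *\<^sub>R p"
    by (simp add: r_def)
qed

text \<open>Near \<open>t0\<close> the curve is a graph over its tangent direction, so vertical
  translates of it fill a chart in which it is straight. Validity of \<open>t0\<close> keeps the
  earlier part of the curve away from the chart; what follows the head is cut off. A slide along the
  axis then carries one head to the other without disturbing the rest.\<close>

lemma isotopic_away_from_crossing:
  assumes D: "knotoid_diagram D" and t0: "0 < t0" "t0 \<le> 1" and valid: "valid D t0"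
  obtains \<epsilon> where "\<epsilon> > 0"
    "\<And>c c'. \<bar>c - t0\<bar> < \<epsilon> \<Longrightarrow> \<bar>c' - t0\<bar> < \<epsilon> \<Longrightarrow> c \<in> {0<..1} \<Longrightarrow> c' \<in> {0<..1} \<Longrightarrow>
       valid D c \<Longrightarrow> valid D c' \<Longrightarrow> isotopic (trunc D c') (trunc D c)"
proof -
  let ?\<gamma> = "curve D"
  define p where "p = ?\<gamma> t0"
  have smooth: "smooth_curve ?\<gamma>" and S: "\<And>t. t \<in> {0..1} \<Longrightarrow> norm (?\<gamma> t) = 1"
    using D by (simp_all add: knotoid_diagram_def image_subset_iff)
  have \<gamma>_cont: "continuous_on {0..1} ?\<gamma>" using smooth by (rule continuous_on_curve)
  define v where "v = velocity D t0"
  have v: "v \<noteq> 0" using D t0 by (simp add: knotoid_diagram_def v_def)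
  define e where "e = (1 / norm v) *\<^sub>R v"
  define n where "n = cross3 p e"
  have np: "norm p = 1" using S t0 by (simp add: p_def)
  have ne: "norm e = 1" using v by (simp add: e_def)
  have pe0: "p \<bullet> e = 0"
    using velocity_tangent[OF D, of t0] t0 by (simp add: e_def p_def v_def)
  note frame = orthonormal_frame_expand[OF np ne pe0, folded n_def]
  have ip: "p \<bullet> p = 1" "e \<bullet> e = 1" "n \<bullet> n = 1" "e \<bullet> p = 0" "p \<bullet> e = 0" "n \<bullet> p = 0" "n \<bullet> e = 0"
    "p \<bullet> n = 0" "e \<bullet> n = 0"
    using np ne pe0 frame(2-4) by (simp_all add: norm_eq_1 inner_commute)
  \<comment> \<open>\<open>L\<close> inverts the orthogonal projection of the hemisphere around
    \<open>p\<close> to the tangent plane. The formula is continuous on the whole plane, but is used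
    as a chart of the sphere where \<open>x\<^sup>2 + y\<^sup>2 < 1\<close>.\<close>
  define L where "L = (\<lambda>(x, y). x *\<^sub>R e + y *\<^sub>R n + sqrt (1 - x\<^sup>2 - y\<^sup>2) *\<^sub>R p)"
  have L_cont: "continuous_on UNIV L"
    unfolding L_def case_prod_unfold by (intro continuous_intros)
  have L_dot: "L (x, y) \<bullet> e = x" "L (x, y) \<bullet> n = y" "L (x, y) \<bullet> p = sqrt (1 - x\<^sup>2 - y\<^sup>2)" for x y
    using ip by (simp_all add: L_def inner_add)
  have norm_frame: "norm q ^ 2 = (q \<bullet> e)\<^sup>2 + (q \<bullet> n)\<^sup>2 + (q \<bullet> p)\<^sup>2" for q
  proof -
    have "norm q ^ 2 = q \<bullet> ((q \<bullet> e) *\<^sub>R e + (q \<bullet> n) *\<^sub>R n + (q \<bullet> p) *\<^sub>R p)"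
      using frame(1)[of q] by (simp add: power2_norm_eq_inner)
    thus ?thesis by (simp add: inner_add power2_eq_square)
  qed
  have L_unique: "q = L (q \<bullet> e, q \<bullet> n)" if "norm q = 1" "q \<bullet> p > 0" for q
  proof -
    have "1 - (q \<bullet> e)\<^sup>2 - (q \<bullet> n)\<^sup>2 = (q \<bullet> p)\<^sup>2" using norm_frame[of q] that by simp
    hence "sqrt (1 - (q \<bullet> e)\<^sup>2 - (q \<bullet> n)\<^sup>2) = q \<bullet> p" using that by simp
    thus ?thesis using frame(1)[of q] by (simp add: L_def)
  qed
  have L_norm: "norm (L (x, y)) = 1" if "x\<^sup>2 + y\<^sup>2 < 1" for x y
  proof -
    have "norm (L (x, y)) ^ 2 = 1" using norm_frame[of "L (x, y)"] that by (simp add: L_dot)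
    thus ?thesis by (simp add: power2_eq_1_iff) (smt (verit) norm_ge_zero)
  qed
  text \<open>
    In the chart \<open>(t, w) \<mapsto> L (X t, Y t + w)\<close> about \<open>p\<close> the curve is the axis \<open>w = 0\<close>; for \<open>t0 = 1\<close>
    the chart needs values of \<open>X\<close> and \<open>Y\<close> beyond the end of the curve.
  \<close>
  define X where "X = (\<lambda>t. ?\<gamma> (min t 1) \<bullet> e + max 0 (t - 1))"
  define Y where "Y = (\<lambda>t. ?\<gamma> (min t 1) \<bullet> n)"
  have clamp: "continuous_on {0..} (\<lambda>t. ?\<gamma> (min t 1))"
    by (intro continuous_on_compose2[OF \<gamma>_cont] continuous_intros) auto
  have X_cont: "continuous_on {0..} X" and Y_cont: "continuous_on {0..} Y"
    unfolding X_def Y_def using clamp by (intro continuous_intros; simp)+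
  have XY: "X t = ?\<gamma> t \<bullet> e" "Y t = ?\<gamma> t \<bullet> n" if "t \<le> 1" for t
    using that by (simp_all add: X_def Y_def)

  obtain \<delta>0 where \<delta>0: "\<delta>0 > 0"
    "\<And>s t. s \<in> {0..1} \<Longrightarrow> t \<in> {0..1} \<Longrightarrow> \<bar>s - t0\<bar> \<le> \<delta>0 \<Longrightarrow> \<bar>t - t0\<bar> \<le> \<delta>0 \<Longrightarrow>
       velocity D s \<bullet> velocity D t > 0"
    by (rule velocity_acute_nearby[OF D, of t0]) (use t0 in auto)
  \<comment> \<open>Distance at most 1 from \<open>p\<close> means an inner product of at least 1/2,
    which places the curve in the hemisphere covered by \<open>L\<close>.\<close>
  have "\<exists>\<delta>>0. \<forall>t\<in>{0..1}. dist t t0 < \<delta> \<longrightarrow> dist (?\<gamma> t) p < 1"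
    using \<gamma>_cont t0 zero_less_one unfolding continuous_on_iff p_def
    by (metis (no_types, lifting) atLeastAtMost_iff less_imp_le)
  then obtain \<delta>2 where \<delta>2: "\<delta>2 > 0" "\<And>t. t \<in> {0..1} \<Longrightarrow> dist t t0 < \<delta>2 \<Longrightarrow> dist (?\<gamma> t) p < 1"
    by blast
  define \<delta>1 where "\<delta>1 = min \<delta>0 (min (\<delta>2 / 2) (t0 / 2))"
  have \<delta>1: "\<delta>1 > 0" "\<delta>1 \<le> \<delta>0" "\<delta>1 < \<delta>2" "\<delta>1 < t0"
    using \<delta>0(1) \<delta>2(1) t0(1) unfolding \<delta>1_def by linarith+
  have \<gamma>p: "?\<gamma> t \<bullet> p > 0" if "t \<in> {0..1}" "\<bar>t - t0\<bar> \<le> \<delta>1" for t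
  proof -
    have "dist (?\<gamma> t) p < 1" using \<delta>2(2)[OF that(1)] that(2) \<delta>1 by (simp add: dist_real_def)
    hence "dist (?\<gamma> t) p \<le> 1" by simp
    thus ?thesis using cball_sphere_iff(1)[OF S[OF that(1)] np, of 1] by simp
  qed
  have X_mono: "X s < X t" if st: "t0 - \<delta>1 \<le> s" "s < t" "t \<le> t0 + \<delta>1" for s t
  proof -
    have acute: "velocity D x \<bullet> e > 0" if "0 \<le> x" "t0 - \<delta>1 \<le> x" "x \<le> t0 + \<delta>1" "x \<le> 1" for x
    proof -
      have "velocity D x \<bullet> v > 0"
        unfolding v_def by (rule \<delta>0(2)) (use that t0 \<delta>1 \<delta>0(1) in auto)
      thus ?thesis using v by (simp add: e_def)
    qed
    have incr: "?\<gamma> a \<bullet> e < ?\<gamma> b \<bullet> e" if "t0 - \<delta>1 \<le> a" "a < b" "b \<le> t0 + \<delta>1" "b \<le> 1" for a b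
      by (rule curve_increasing_along[OF smooth]) (use that \<delta>1 acute in auto)
    consider "t \<le> 1" | "s < 1" "1 < t" | "1 \<le> s" by linarith
    thus ?thesis
    proof cases
      case 1 thus ?thesis using incr[of s t] st XY[of s] XY[of t] by simp
    next
      case 2 thus ?thesis using incr[of s 1] st XY[of s] by (simp add: X_def)
    next
      case 3 thus ?thesis using st by (simp add: X_def min_def)
    qed
  qed
  have \<gamma>_L: "?\<gamma> t = L (X t, Y t)" if "t \<in> {0..1}" "\<bar>t - t0\<bar> \<le> \<delta>1" for t
    using L_unique[OF S[OF that(1)] \<gamma>p[OF that]] XY[of t] that(1) by simp

  have "closed (?\<gamma> ` {0..t0 - \<delta>1})"
    using continuous_on_subset[OF \<gamma>_cont, of "{0..t0 - \<delta>1}"] t0 \<delta>1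
    by (intro compact_imp_closed compact_continuous_image) auto
  moreover have "p \<notin> ?\<gamma> ` {0..t0 - \<delta>1}"
    using valid \<delta>1(1) unfolding valid_def p_def by force
  ultimately obtain \<eta> where \<eta>: "\<eta> > 0" "\<And>t. t \<in> {0..t0 - \<delta>1} \<Longrightarrow> \<eta> \<le> dist p (?\<gamma> t)"
    using separate_point_closed[of "?\<gamma> ` {0..t0 - \<delta>1}" p] by blast
  define N where "N = (\<lambda>(t, w). (X t, Y t + w))"
  have N_cont: "continuous_on ({0..} \<times> UNIV) N"
    unfolding N_def case_prod_unfold
    by (intro continuous_intros continuous_on_compose2[OF X_cont] continuous_on_compose2[OF Y_cont]) auto
  \<comment> \<open>The chart must stay in the domain of \<open>L\<close> and closer to
    \<open>p\<close> than the part of the curve before \<open>t0 - \<delta>1\<close>.\<close>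
  define U where "U = {z. fst z ^ 2 + snd z ^ 2 < 1 \<and> dist p (L z) < \<eta>}"
  have "open U"
  proof -
    have "open {z::real \<times> real. fst z ^ 2 + snd z ^ 2 < 1}"
      by (intro open_Collect_less continuous_intros)
    moreover have "open {z. dist p (L z) < \<eta>}"
      using L_cont by (intro open_Collect_less continuous_intros)
    ultimately show ?thesis unfolding U_def by (simp add: Collect_conj_eq open_Int)
  qed
  moreover have "N (t0, 0) \<in> U"
  proof -
    have "X t0 = 0" "Y t0 = 0" using XY[of t0] t0 ip by (simp_all add: p_def[symmetric])
    moreover have "L (0, 0) = p" by (simp add: L_def)
    ultimately show ?thesis using \<eta>(1) by (simp add: N_def U_def)
  qed
  ultimately obtain \<theta> where \<theta>: "\<theta> > 0"
    "\<And>z. z \<in> {0..} \<times> UNIV \<Longrightarrow> dist z (t0, 0) < \<theta> \<Longrightarrow> N z \<in> U"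
  proof -
    obtain r where r: "r > 0" "ball (N (t0, 0)) r \<subseteq> U"
      using \<open>open U\<close> \<open>N (t0, 0) \<in> U\<close> open_contains_ball by blast
    have "(t0, 0) \<in> {0..} \<times> (UNIV :: real set)" using t0 by simp
    then obtain \<theta> where "\<theta> > 0"
      "\<forall>z\<in>{0..} \<times> UNIV. dist z (t0, 0) < \<theta> \<longrightarrow> dist (N z) (N (t0, 0)) < r"
      using N_cont r(1) unfolding continuous_on_iff by blast
    thus thesis using that r(2) by (metis dist_commute mem_ball subsetD)
  qed
  define d where "d = min \<delta>1 (\<theta> / 3)"
  have d: "0 < d" "d \<le> \<delta>1" "2 * d < \<theta>" using \<delta>1(1) \<theta>(1) unfolding d_def by linarith+
  define Q where "Q = cbox (t0 - d, - d) (t0 + d, d)"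
  have Q: "Q = {t0-d..t0+d} \<times> {-d..d}" by (simp add: Q_def cbox_Pair_eq)
  have Q_pos: "Q \<subseteq> {0..} \<times> UNIV" using d \<delta>1 unfolding Q by auto
  have NU: "N z \<in> U" if "z \<in> Q" for z
  proof (rule \<theta>(2))
    show "z \<in> {0..} \<times> UNIV" using that Q_pos by blast
    have "dist z (t0, 0) \<le> \<bar>fst z - t0\<bar> + \<bar>snd z\<bar>"
      using sqrt_sum_squares_le_sum_abs[of "fst z - t0" "snd z"]
      by (simp add: dist_prod_def dist_real_def case_prod_unfold)
    also have "\<dots> \<le> 2 * d" using that unfolding Q by (auto simp: abs_le_iff)
    finally show "dist z (t0, 0) < \<theta>" using d(3) by simp
  qed
  have N_inj: "inj_on N Q"
  proof (rule inj_onI)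
    fix z z' assume z: "z \<in> Q" "z' \<in> Q" "N z = N z'"
    obtain t w t' w' where tw: "z = (t, w)" "z' = (t', w')" by fastforce
    have "X t = X t'" "Y t + w = Y t' + w'" using z(3) tw by (simp_all add: N_def)
    moreover have "t0 - \<delta>1 \<le> t" "t \<le> t0 + \<delta>1" "t0 - \<delta>1 \<le> t'" "t' \<le> t0 + \<delta>1"
      using z tw d(2) by (auto simp: Q)
    ultimately show "z = z'" using X_mono[of t t'] X_mono[of t' t] tw by (cases t t' rule: linorder_cases) auto
  qed
  define \<Psi> where "\<Psi> = (\<lambda>z. L (N z))"
  have \<Psi>_cont: "continuous_on Q \<Psi>"
    unfolding \<Psi>_def
    using continuous_on_compose2[OF L_cont continuous_on_subset[OF N_cont Q_pos]] by simp
  have \<Psi>_dot: "\<Psi> z \<bullet> e = fst (N z)" "\<Psi> z \<bullet> n = snd (N z)" for z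
    using L_dot[of "fst (N z)" "snd (N z)"] by (simp_all add: \<Psi>_def)
  have \<Psi>_inj: "inj_on \<Psi> Q"
    using N_inj \<Psi>_dot unfolding inj_on_def by (metis prod.expand)
  have \<Psi>S: "norm (\<Psi> z) = 1" and \<Psi>p: "\<Psi> z \<bullet> p > 0" and \<Psi>\<eta>: "dist p (\<Psi> z) < \<eta>" if "z \<in> Q" for z
  proof -
    have z: "fst (N z) ^ 2 + snd (N z) ^ 2 < 1" "dist p (L (N z)) < \<eta>"
      using NU[OF that] by (auto simp: U_def)
    show "norm (\<Psi> z) = 1" using L_norm[OF z(1)] by (simp add: \<Psi>_def)
    show "\<Psi> z \<bullet> p > 0" using L_dot(3)[of "fst (N z)" "snd (N z)"] z(1) by (simp add: \<Psi>_def)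
    show "dist p (\<Psi> z) < \<eta>" using z(2) by (simp add: \<Psi>_def)
  qed
  have \<Psi>_open: "openin (top_of_set S2) (\<Psi> ` interior Q)"
  proof -
    \<comment> \<open>\<open>N\<close> is only known to be continuous and injective, so openness
      comes from invariance of domain; projecting to the coordinates along \<open>e\<close> and
      \<open>n\<close> transfers it to the sphere.\<close>
    have "open (N ` interior Q)"
    proof (rule invariance_of_domain)
      show "continuous_on (interior Q) N"
        using continuous_on_subset[OF N_cont] interior_subset[of Q] Q_pos by blast
      show "inj_on N (interior Q)" using inj_on_subset[OF N_inj interior_subset] .
    qed simp
    hence op: "open ({q. 0 < q \<bullet> p} \<inter> (\<lambda>q. (q \<bullet> e, q \<bullet> n)) -` (N ` interior Q))"
      by (intro open_Int open_vimage open_Collect_less continuous_intros)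
    have eq: "\<Psi> ` interior Q = S2 \<inter> ({q. 0 < q \<bullet> p} \<inter> (\<lambda>q. (q \<bullet> e, q \<bullet> n)) -` (N ` interior Q))"
    proof (intro equalityI subsetI)
      fix q assume "q \<in> \<Psi> ` interior Q"
      then obtain z where z: "z \<in> interior Q" "q = \<Psi> z" by blast
      hence "z \<in> Q" using interior_subset by blast
      thus "q \<in> S2 \<inter> ({q. 0 < q \<bullet> p} \<inter> (\<lambda>q. (q \<bullet> e, q \<bullet> n)) -` (N ` interior Q))"
        using z \<Psi>S \<Psi>p by (simp add: \<Psi>_dot)
    next
      fix q assume q: "q \<in> S2 \<inter> ({q. 0 < q \<bullet> p} \<inter> (\<lambda>q. (q \<bullet> e, q \<bullet> n)) -` (N ` interior Q))"
      then obtain z where "z \<in> interior Q" "(q \<bullet> e, q \<bullet> n) = N z" by blast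
      moreover have "q = L (q \<bullet> e, q \<bullet> n)" using q by (intro L_unique) auto
      ultimately show "q \<in> \<Psi> ` interior Q" unfolding \<Psi>_def by (metis imageI)
    qed
    show ?thesis unfolding eq using op by (rule openin_open_Int)
  qed
  have \<gamma>_\<Psi>: "?\<gamma> t = \<Psi> (t, 0)" if "t \<in> {0..1}" "\<bar>t - t0\<bar> \<le> d" for t
    using \<gamma>_L[OF that(1)] that(2) d by (simp add: \<Psi>_def N_def)
  have main: "isotopic (trunc D c') (trunc D c)"
    if c: "\<bar>c - t0\<bar> < d / 4" "\<bar>c' - t0\<bar> < d / 4" "c \<in> {0<..1}" "c' \<in> {0<..1}"
      "valid D c" "valid D c'" for c c'
  proof -
    \<comment> \<open>This value solves \<open>f c' = c\<close>. Both heads lie within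
      \<open>d / 4\<close> of \<open>t0\<close>, so the numerator is below \<open>d / 2\<close> and
      the denominator above \<open>3 / 4 * d\<close>. The sign is free: the slide may shorten or
      lengthen the curve.\<close>
    define \<mu> where "\<mu> = (c' - c) / (d - \<bar>c' - t0\<bar>)"
    have pos: "d - \<bar>c' - t0\<bar> > 3 / 4 * d" using c by linarith
    have "\<bar>c' - c\<bar> < d / 2" using c by linarith
    hence "\<bar>c' - c\<bar> < d - \<bar>c' - t0\<bar>" using pos d(1) by linarith
    hence \<mu>: "\<bar>\<mu>\<bar> < 1" using pos d(1) unfolding \<mu>_def by (simp add: abs_divide)
    define f where "f = (\<lambda>t. t - \<mu> * max 0 (d - \<bar>t - t0\<bar>))"
    have f_less: "f s < f t" if "s < t" for s t
      unfolding f_def by (rule slide_strict_mono[OF \<mu> that])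
    have fc: "f c' = c" using pos d(1) unfolding f_def \<mu>_def by simp
    have f_id: "f t = t" if "d \<le> \<bar>t - t0\<bar>" for t using that by (simp add: f_def)
    have f0: "f 0 = 0" using f_id[of 0] d \<delta>1 by simp
    obtain h where h: "homotopic_with_canon (\<lambda>g. \<exists>g'. homeomorphism S2 S2 g g') S2 S2 id h"
      "\<And>z. z \<in> Q \<Longrightarrow> h (\<Psi> z) =
         \<Psi> ((\<lambda>\<tau> (t, w). (t - \<tau> * \<mu> * (1 - \<bar>w\<bar> / d) * max 0 (d - \<bar>t - t0\<bar>), w)) 1 z)"
      "\<And>q. q \<in> S2 - \<Psi> ` interior Q \<Longrightarrow> h q = q"
    proof (rule isotopy_extended_by_identity[OF _ \<Psi>_cont \<Psi>_inj _ \<Psi>_open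
          slide_rectangle[OF \<mu> d(1), where ?t0.0 = t0, folded Q_def]])
      show "compact Q" by (simp add: Q_def)
      show "\<Psi> ` Q \<subseteq> S2" using \<Psi>S by auto
    qed (assumption+, rule that)
    have h\<gamma>: "h (?\<gamma> s) = ?\<gamma> (f s)" if s: "0 \<le> s" "s \<le> c'" for s
    proof (cases "\<bar>s - t0\<bar> \<le> d")
      case True
      \<comment> \<open>The bound by \<open>c \<le> 1\<close> matters: beyond the parameter 1 the
        axis of the chart no longer represents the curve.\<close>
      have "f s \<le> c" using f_less[of s c'] fc s by (cases "s = c'") auto
      moreover have "t0 - d \<le> f s"
        using f_less[of "t0 - d" s] f_id[of "t0 - d"] True d(1)
        by (cases "s = t0 - d") (auto simp: abs_le_iff)
      moreover have "c \<le> t0 + d" "c \<le> 1" "0 \<le> t0 - d"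
        using c(1,3) d(1,2) \<delta>1(4) by (simp_all, linarith)
      ultimately have fs: "f s \<in> {0..1}" "\<bar>f s - t0\<bar> \<le> d"
        by (auto simp: abs_le_iff)
      have "(s, 0) \<in> Q" using True d(1) unfolding Q by (auto simp: abs_le_iff)
      hence "h (\<Psi> (s, 0)) = \<Psi> (f s, 0)" using h(2)[of "(s, 0)"] by (simp add: f_def)
      thus ?thesis using \<gamma>_\<Psi>[OF _ True] \<gamma>_\<Psi>[OF fs] s c by simp
    next
      case False
      have "s \<le> t0 + d" using s(2) c(2) d(1) by linarith
      hence s': "s < t0 - d" using False by linarith
      \<comment> \<open>Points well before \<open>t0\<close> are too far from \<open>p\<close>; for
        those within \<open>\<delta>1\<close> of \<open>t0\<close> the coordinate along
        \<open>e\<close> is smaller than anywhere in the chart.\<close>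
      have "?\<gamma> s \<notin> \<Psi> ` Q"
      proof
        assume "?\<gamma> s \<in> \<Psi> ` Q"
        then obtain t w where tw: "(t, w) \<in> Q" "?\<gamma> s = \<Psi> (t, w)" by auto
        show False
        proof (cases "s \<le> t0 - \<delta>1")
          case True
          thus False using \<eta>(2)[of s] s(1) \<Psi>\<eta>[OF tw(1)] tw(2) by simp
        next
          case False
          have "X s = ?\<gamma> s \<bullet> e" using XY(1)[of s] s c by simp
          also have "\<dots> = X t" using tw(2) \<Psi>_dot(1)[of "(t, w)"] by (simp add: N_def)
          finally show False using X_mono[of s t] tw(1) s' False d(2) by (auto simp: Q)
        qed
      qed
      moreover have "?\<gamma> s \<in> S2" using S[of s] s c by simp
      ultimately have "h (?\<gamma> s) = ?\<gamma> s" using h(3)[of "?\<gamma> s"] interior_subset[of Q] by blast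
      thus ?thesis using f_id[of s] s' by simp
    qed
    define \<rho> where "\<rho> = (\<lambda>t. f (c' * t) / c)"
    have "reparam \<rho>"
      unfolding \<rho>_def
    proof (rule reparam_rescale)
      show "strict_mono_on {0..c'} f" using f_less by (simp add: strict_mono_on_def)
      show "continuous_on {0..c'} f" unfolding f_def by (intro continuous_intros)
    qed (use c f0 fc in auto)
    moreover have "h (curve (trunc D c') t) = curve (trunc D c) (\<rho> t)" if "t \<in> {0..1}" for t
      using h\<gamma>[of "c' * t"] that c by (simp add: \<rho>_def mult_left_le)
    moreover have "knotoid_diagram (trunc D c)" "knotoid_diagram (trunc D c')"
      using c by (auto intro: knotoid_diagram_trunc[OF D])
    ultimately show ?thesis
      unfolding isotopic_def using h(1) by (intro conjI exI[of _ h] exI[of _ \<rho>]) auto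
  qed
  show thesis by (rule that[of "d / 4"]) (use d(1) main in auto)
qed

subsection \<open>Pulling the head back to the tail\<close>

lemma finite_invalid:
  assumes D: "knotoid_diagram D"
  shows "finite {c \<in> {0..1}. \<not> valid D c}"
  by (rule finite_subset[OF _ finite_crossing_parameters[OF D]])
    (force simp: valid_def crossing_def)

lemma valid_between:
  assumes D: "knotoid_diagram D" and ab: "a < b" "0 \<le> a" "b \<le> 1"
  obtains z where "a < z" "z < b" "valid D z"
proof -
  have "infinite {a<..<b}" using ab by simp
  hence "infinite ({a<..<b} - {c \<in> {0..1}. \<not> valid D c})"
    using finite_invalid[OF D] by (rule Diff_infinite_finite[rotated])
  then obtain z where "z \<in> {a<..<b} - {c \<in> {0..1}. \<not> valid D c}"
    using infinite_imp_nonempty by blast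
  thus thesis using that ab by auto
qed

text \<open>Uniform form of the two local results. At a crossing, two heads on the same side are
  connected by going through the crossing and back, since moves are reversible.\<close>

lemma trunc_local:
  assumes D: "knotoid_diagram D" and x: "0 < x" "x \<le> 1"
  obtains \<epsilon> where "\<epsilon> > 0"
    "\<And>c c'. \<bar>c - x\<bar> < \<epsilon> \<Longrightarrow> \<bar>c' - x\<bar> < \<epsilon> \<Longrightarrow> c \<in> {0<..1} \<Longrightarrow> c' \<in> {0<..1} \<Longrightarrow>
       valid D c \<Longrightarrow> valid D c' \<Longrightarrow> pw_step\<^sup>*\<^sup>* (trunc D c') (trunc D c)"
proof (cases "valid D x")
  case True
  obtain \<epsilon> where \<epsilon>: "\<epsilon> > 0"
    "\<And>c c'. \<bar>c - x\<bar> < \<epsilon> \<Longrightarrow> \<bar>c' - x\<bar> < \<epsilon> \<Longrightarrow> c \<in> {0<..1} \<Longrightarrow> c' \<in> {0<..1} \<Longrightarrow>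
       valid D c \<Longrightarrow> valid D c' \<Longrightarrow> isotopic (trunc D c') (trunc D c)"
    using isotopic_away_from_crossing[OF D x True] by blast
  show thesis
    by (rule that[OF \<epsilon>(1)]) (use \<epsilon>(2) in \<open>auto simp: pw_step_def intro!: r_into_rtranclp\<close>)
next
  case False
  then obtain s0 where "0 \<le> s0" "s0 < x" "curve D s0 = curve D x" by (auto simp: valid_def)
  with x have cross: "crossing D s0 x" "s0 < x" by (auto simp: crossing_def)
  obtain \<epsilon> where \<epsilon>: "\<epsilon> > 0"
    "\<And>c c'. x - \<epsilon> < c \<Longrightarrow> c < x \<Longrightarrow> x < c' \<Longrightarrow> c' < x + \<epsilon> \<Longrightarrow> Omega_v (trunc D c) (trunc D c')"
    "\<And>c. \<bar>c - x\<bar> < \<epsilon> \<Longrightarrow> c \<noteq> x \<Longrightarrow> valid D c"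
    using Omega_v_at_crossing[OF D cross] by blast
  have step: "pw_step (trunc D c) (trunc D c')"
    if "\<bar>c - x\<bar> < \<epsilon>" "\<bar>c' - x\<bar> < \<epsilon>" "c < x \<and> x < c' \<or> c' < x \<and> x < c" for c c'
    using that \<epsilon>(2)[of c c'] \<epsilon>(2)[of c' c] by (auto simp: pw_step_def pw_move_def)
  show thesis
  proof (rule that[OF \<epsilon>(1)])
    fix c c'
    assume cc: "\<bar>c - x\<bar> < \<epsilon>" "\<bar>c' - x\<bar> < \<epsilon>" "valid D c" "valid D c'"
    hence ne: "c \<noteq> x" "c' \<noteq> x" using False by auto
    \<comment> \<open>An auxiliary head on the side of \<open>x\<close> opposite to
      \<open>c\<close>.\<close>
    let ?z = "if c < x then x + \<epsilon> / 2 else x - \<epsilon> / 2"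
    show "pw_step\<^sup>*\<^sup>* (trunc D c') (trunc D c)"
    proof (cases "c < x \<longleftrightarrow> c' < x")
      case True
      have "pw_step (trunc D c') (trunc D ?z)" "pw_step (trunc D ?z) (trunc D c)"
        by (rule step; use cc ne True \<epsilon>(1) in auto)+
      thus ?thesis by (meson converse_rtranclp_into_rtranclp r_into_rtranclp)
    next
      case False
      thus ?thesis using cc ne by (intro r_into_rtranclp step) auto
    qed
  qed
qed

text \<open>Bisection of \<open>{a..b}\<close> assembles the local statements, with no enumeration
  of the crossings along the curve.\<close>

lemma shrink_diagram:
  assumes D: "knotoid_diagram D" and ab: "0 < a" "a \<le> b" "b \<le> 1" "valid D a" "valid D b"
  shows "pw_step\<^sup>*\<^sup>* (trunc D b) (trunc D a)"
proof -
  let ?R = "\<lambda>c c'. c \<in> {0<..1} \<and> c' \<in> {0<..1} \<and> c \<le> c' \<and> valid D c \<and> valid D c' \<longrightarrow>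
    pw_step\<^sup>*\<^sup>* (trunc D c') (trunc D c)"
  text \<open>
    The margin \<open>\<epsilon>\<close> lets the property compose at a point where the truncated curve is not a
    diagram.
  \<close>
  define P where "P = (\<lambda>a b. \<exists>\<epsilon>>0. \<forall>c c'. a - \<epsilon> < c \<and> c' < b + \<epsilon> \<longrightarrow> ?R c c')"
  have "P a b"
    using ab(2)
  proof (induction rule: Bolzano)
    case (trans a b c)
    obtain \<epsilon>1 where \<epsilon>1: "\<epsilon>1 > 0" "\<And>s t. a - \<epsilon>1 < s \<Longrightarrow> t < b + \<epsilon>1 \<Longrightarrow> ?R s t"
      using trans(1) unfolding P_def by blast
    obtain \<epsilon>2 where \<epsilon>2: "\<epsilon>2 > 0" "\<And>s t. b - \<epsilon>2 < s \<Longrightarrow> t < c + \<epsilon>2 \<Longrightarrow> ?R s t"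
      using trans(2) unfolding P_def by blast
    define \<epsilon> where "\<epsilon> = min \<epsilon>1 \<epsilon>2"
    have \<epsilon>: "\<epsilon> > 0" "\<epsilon> \<le> \<epsilon>1" "\<epsilon> \<le> \<epsilon>2" using \<epsilon>1(1) \<epsilon>2(1) by (auto simp: \<epsilon>_def)
    have "?R s t" if st: "a - \<epsilon> < s" "t < c + \<epsilon>" for s t
    proof
      assume *: "s \<in> {0<..1} \<and> t \<in> {0<..1} \<and> s \<le> t \<and> valid D s \<and> valid D t"
      consider "t < b + \<epsilon>" | "b - \<epsilon> < s" | "s \<le> b - \<epsilon>" "b + \<epsilon> \<le> t" by linarith
      thus "pw_step\<^sup>*\<^sup>* (trunc D t) (trunc D s)"
      proof cases
        case 1 thus ?thesis using \<epsilon>1(2)[of s t] * st \<epsilon> by simp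
      next
        case 2 thus ?thesis using \<epsilon>2(2)[of s t] * st \<epsilon> by simp
      next
        case 3
        \<comment> \<open>Since \<open>b\<close> itself may be invalid, a valid head within the
          common margin serves as the intermediate stop.\<close>
        obtain z where z: "b - \<epsilon> < z" "z < b + \<epsilon>" "valid D z"
          by (rule valid_between[OF D, of "b - \<epsilon>" "b + \<epsilon>"]) (use 3 * \<epsilon>(1) in auto)
        have "pw_step\<^sup>*\<^sup>* (trunc D t) (trunc D z)" using \<epsilon>2(2)[of z t] * st \<epsilon> z 3 by simp
        moreover have "pw_step\<^sup>*\<^sup>* (trunc D z) (trunc D s)" using \<epsilon>1(2)[of s z] * st \<epsilon> z 3 by simp
        ultimately show ?thesis by (rule rtranclp_trans)
      qed
    qed
    thus ?case unfolding P_def using \<epsilon>(1) by blast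
  next
    case (local x)
    have "0 < x" "x \<le> 1" using local ab by auto
    then obtain \<epsilon> where \<epsilon>: "\<epsilon> > 0"
      "\<And>c c'. \<bar>c - x\<bar> < \<epsilon> \<Longrightarrow> \<bar>c' - x\<bar> < \<epsilon> \<Longrightarrow> c \<in> {0<..1} \<Longrightarrow> c' \<in> {0<..1} \<Longrightarrow>
         valid D c \<Longrightarrow> valid D c' \<Longrightarrow> pw_step\<^sup>*\<^sup>* (trunc D c') (trunc D c)"
      using trunc_local[OF D] by blast
    \<comment> \<open>Half of \<open>\<epsilon>\<close> bounds the length of the interval, the other
      half is its margin; together they keep both heads within \<open>\<epsilon>\<close> of
      \<open>x\<close>.\<close>
    have "P u v" if uv: "u \<le> x" "x \<le> v" "v - u < \<epsilon> / 2" for u v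
    proof -
      have "?R c c'" if "u - \<epsilon> / 2 < c" "c' < v + \<epsilon> / 2" for c c'
      proof
        assume *: "c \<in> {0<..1} \<and> c' \<in> {0<..1} \<and> c \<le> c' \<and> valid D c \<and> valid D c'"
        hence "\<bar>c - x\<bar> < \<epsilon>" "\<bar>c' - x\<bar> < \<epsilon>" using that uv by (auto simp: abs_less_iff)
        thus "pw_step\<^sup>*\<^sup>* (trunc D c') (trunc D c)" using \<epsilon>(2) * by blast
      qed
      thus ?thesis unfolding P_def using \<epsilon>(1) by (intro exI[of _ "\<epsilon> / 2"]) auto
    qed
    thus ?case using \<epsilon>(1) by (intro exI[of _ "\<epsilon> / 2"]) auto
  qed
  then obtain \<epsilon> where "\<epsilon> > 0" "\<forall>c c'. a - \<epsilon> < c \<and> c' < b + \<epsilon> \<longrightarrow> ?R c c'"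
    unfolding P_def by blast
  thus ?thesis using ab by auto
qed

text \<open>The tail is not on a crossing and crossing parameters are isolated, so a short initial
  segment contains none and is embedded.\<close>

lemma trivial_initial_segment:
  assumes D: "knotoid_diagram D"
  obtains a where "0 < a" "a \<le> 1" "valid D a" "trivial_diagram (trunc D a)"
proof -
  obtain \<delta> where \<delta>: "\<delta> > 0" "\<And>s t. crossing D s t \<Longrightarrow> \<bar>s - 0\<bar> \<le> \<delta> \<Longrightarrow> s = 0"
    using isolated_crossing[OF D] by blast
  define a where "a = min \<delta> 1"
  have a: "0 < a" "a \<le> 1" using \<delta>(1) by (auto simp: a_def)
  have inj: "s = t" if "s \<in> {0..a}" "t \<in> {0..a}" "curve D s = curve D t" for s t
  proof (rule ccontr)
    assume "s \<noteq> t"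
    hence "crossing D s t" using that a by (auto simp: crossing_def)
    moreover from this have "s = 0" using \<delta>(2) that by (auto simp: a_def)
    ultimately show False using D by (simp add: knotoid_diagram_def)
  qed
  have valid: "valid D a"
    using inj[of _ a] a by (force simp: valid_def)
  moreover have "inj_on (curve (trunc D a)) {0..1}"
  proof (rule inj_onI)
    fix x y assume "x \<in> {0..1}" "y \<in> {0..1}" "curve (trunc D a) x = curve (trunc D a) y"
    thus "x = y" using inj[of "a * x" "a * y"] a by (simp add: mult_left_le)
  qed
  ultimately show thesis
    using that a knotoid_diagram_trunc[OF D a] by (simp add: trivial_diagram_def)
qed

theorem proposition6p1:
  fixes D :: diagram
  assumes "knotoid_diagram D"
  shows "\<exists>D'. trivial_diagram D' \<and>
           (\<lambda>E E'. virtualization E E' \<or> pw_step E E')\<^sup>*\<^sup>* D D'"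
proof -
  obtain a where a: "0 < a" "a \<le> 1" "valid D a" "trivial_diagram (trunc D a)"
    using trivial_initial_segment[OF assms] by blast
  \<comment> \<open>The retraction can start at the full curve because the head of a diagram lies on
    no crossing.\<close>
  have "valid D 1"
  proof (unfold valid_def, intro allI impI notI)
    fix s :: real assume "0 \<le> s \<and> s < 1" "curve D s = curve D 1"
    hence "crossing D 1 s" by (simp add: crossing_def)
    with assms show False by (simp add: knotoid_diagram_def)
  qed
  hence "pw_step\<^sup>*\<^sup>* (trunc D 1) (trunc D a)"
    using shrink_diagram[OF assms] a by simp
  hence "(\<lambda>E E'. virtualization E E' \<or> pw_step E E')\<^sup>*\<^sup>* (trunc D 1) (trunc D a)"
    by (rule rtranclp_mono[THEN predicate2D, rotated]) auto
  with virtualize_all[OF assms] a(4) show ?thesis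
    by (meson rtranclp_trans)
qed

end
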